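(* Let $\mathcal{A}$ be a unital $*$-algebra and let $Z$ be a linear hermitian functional on $\mathcal{A}$ with $Z(1)=1$. Then $Z$ admits GNS data if and only if there exists a positive definite scalar kernel $L$ on $\mathcal{A}$ such that $$\Big|Z\Big(\sum_{i,j=1}^n\lambda_i\overline{\lambda}_j x_ix_j^*\Big)\Big|\le\sum_{i,j=1}^n\lambda_i\overline{\lambda}_jL(x_i,x_j)$$ for all $n\in\mathbb{N}$, $\{\lambda_i\}_{i=1}^n\subset\mathbb{C}$, $\{x_i\}_{i=1}^n\subset\mathcal{A}$.
   Context: $\mathcal{A}$ is a complex $*$-algebra with identity $1$; $Z$ is hermitian if $Z(a^* )=\overline{Z(a)}$. A scalar kernel $L:\mathcal{A}\times\mathcal{A}\to\mathbb{C}$ is positive definite if it is hermitian ($L(x,y)=\overline{L(y,x)}$) and $\sum_{i,j}L(x_i,x_j)\lambda_j\overline{\lambda_i}\ge0$ for all finite families. A Kreĭn space is an indefinite inner product space $(\mathcal{K},[\cdot,\cdot])$ for which there is a positive inner product $\langle\cdot,\cdot\rangle$ turning $\mathcal{K}$ into a Hilbert space, and $J=J^*=J^{-1}$ on $\mathcal{K}$, with $[\xi,\eta]=\langle J\xi,\eta\rangle$; $\sharp$ denotes the adjoint with respect to $[\cdot,\cdot]$ (for densely defined operators). A closable representation $\pi$ of $\mathcal{A}$ on $\mathcal{K}$ is a linear mapping of $\mathcal{A}$ into the closable operators defined on a common dense domain $\mathcal{D}(\pi)$ of $\mathcal{K}$, with $\mathcal{D}(\pi)$ invariant under all $\pi(a)$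 and $\pi(ab)=\pi(a)\pi(b)$. On a Kreĭn space it is hermitian if for all $a\in\mathcal{A}$ the domain of $\pi(a)^\sharp$ contains $\mathcal{D}(\pi)$ and $\pi(a)^\sharp|\mathcal{D}(\pi)=\pi(a^* )$. GNS data $(\pi,\mathcal{K},\Omega)$ associated to $Z$ consist of a hermitian closable representation $\pi$ of $\mathcal{A}$ on a Kreĭn space $\mathcal{K}$ and a vector $\Omega\in\mathcal{D}(\pi)$ such that $Z(a)=[\pi(a)\Omega,\Omega]_{\mathcal{K}}$ for all $a\in\mathcal{A}$ and $\bigvee_{a\in\mathcal{A}}\pi(a)\Omega=\mathcal{D}(\pi)$, where $\bigvee$ is linear span without closure. *)

theory Defs
  imports "HOL-Analysis.Analysis" "HOL-Library.Function_Algebras" "HOL-Library.Complex_Order"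
begin

section \<open>Complex star-algebras, hermitian functionals, positive definite kernels\<close>

text \<open>The class ring_1 requires 0 and 1 to differ; this is no restriction in the presence of a
  linear functional taking the value 1 at 1.\<close>

locale complex_star_algebra = vector_space scaleA
  for scaleA :: "complex \<Rightarrow> 'a::ring_1 \<Rightarrow> 'a" +
  fixes star :: "'a \<Rightarrow> 'a"
  assumes mult_scale_left: "scaleA c x * y = scaleA c (x * y)"
    and mult_scale_right: "x * scaleA c y = scaleA c (x * y)"
    and star_star: "star (star x) = x"
    and star_add: "star (x + y) = star x + star y"
    and star_scale: "star (scaleA c x) = scaleA (cnj c) (star x)"
    and star_mult: "star (x * y) = star y * star x"

definition hermitian_functional :: "('a \<Rightarrow> 'a) \<Rightarrow> ('a \<Rightarrow> complex) \<Rightarrow> bool" where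
  "hermitian_functional star Z \<longleftrightarrow> (\<forall>a. Z (star a) = cnj (Z a))"

text \<open>The order on the complex numbers is that of Complex_Order: \<open>0 \<le> z\<close> says that z is real and
  nonnegative. Kernels are not assumed to be sesquilinear.\<close>

definition positive_definite_kernel :: "('a \<Rightarrow> 'a \<Rightarrow> complex) \<Rightarrow> bool" where
  "positive_definite_kernel L \<longleftrightarrow>
     (\<forall>x y. L x y = cnj (L y x)) \<and>
     (\<forall>(n::nat) (l :: nat \<Rightarrow> complex) (x :: nat \<Rightarrow> 'a).
        0 \<le> (\<Sum>i<n. \<Sum>j<n. L (x i) (x j) * l j * cnj (l i)))"

section \<open>Krein spaces\<close>

text \<open>Spaces are given by a carrier K inside an ambient complex vector space \<open>'k\<close> with scalar
  multiplication s; forms and operators matter only on K. Forms are linear in the first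
  argument.\<close>

definition hermitian_form_on ::
  "(complex \<Rightarrow> 'k::ab_group_add \<Rightarrow> 'k) \<Rightarrow> 'k set \<Rightarrow> ('k \<Rightarrow> 'k \<Rightarrow> complex) \<Rightarrow> bool" where
  "hermitian_form_on s K f \<longleftrightarrow>
     (\<forall>x\<in>K. \<forall>y\<in>K. \<forall>z\<in>K. f (x + y) z = f x z + f y z) \<and>
     (\<forall>c. \<forall>x\<in>K. \<forall>y\<in>K. f (s c x) y = c * f x y) \<and>
     (\<forall>x\<in>K. \<forall>y\<in>K. f x y = cnj (f y x))"

definition linear_into ::
  "(complex \<Rightarrow> 'k::ab_group_add \<Rightarrow> 'k) \<Rightarrow> 'k set \<Rightarrow> 'k set \<Rightarrow> ('k \<Rightarrow> 'k) \<Rightarrow> bool" where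
  "linear_into s D E T \<longleftrightarrow>
     (\<forall>x\<in>D. T x \<in> E) \<and>
     (\<forall>x\<in>D. \<forall>y\<in>D. T (x + y) = T x + T y) \<and>
     (\<forall>c. \<forall>x\<in>D. T (s c x) = s c (T x))"

text \<open>The value outside K is set to 0 because the locale Metric_space asks for nonnegativity and
  symmetry of the distance on the whole type.\<close>

definition ip_dist :: "'k::ab_group_add set \<Rightarrow> ('k \<Rightarrow> 'k \<Rightarrow> complex) \<Rightarrow> 'k \<Rightarrow> 'k \<Rightarrow> real" where
  "ip_dist K ip x y = (if x \<in> K \<and> y \<in> K then sqrt (Re (ip (x - y) (x - y))) else 0)"

abbreviation ip_topology :: "'k::ab_group_add set \<Rightarrow> ('k \<Rightarrow> 'k \<Rightarrow> complex) \<Rightarrow> 'k topology" where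
  "ip_topology K ip \<equiv> Metric_space.mtopology K (ip_dist K ip)"

definition hilbert_space_on ::
  "(complex \<Rightarrow> 'k::ab_group_add \<Rightarrow> 'k) \<Rightarrow> 'k set \<Rightarrow> ('k \<Rightarrow> 'k \<Rightarrow> complex) \<Rightarrow> bool" where
  "hilbert_space_on s K ip \<longleftrightarrow>
     vector_space s \<and> module.subspace s K \<and>
     hermitian_form_on s K ip \<and>
     (\<forall>x\<in>K. 0 \<le> ip x x) \<and> (\<forall>x\<in>K. ip x x = 0 \<longrightarrow> x = 0) \<and>
     Metric_space.mcomplete K (ip_dist K ip)"

text \<open>\<open>krein_structure s K f ip J\<close>: the inner product ip and the symmetry \<open>J = J* = J\<inverse>\<close> exhibit
  the indefinite inner product space \<open>(K, f)\<close> as a Krein space.\<close>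

definition krein_structure ::
  "(complex \<Rightarrow> 'k::ab_group_add \<Rightarrow> 'k) \<Rightarrow> 'k set \<Rightarrow> ('k \<Rightarrow> 'k \<Rightarrow> complex) \<Rightarrow>
   ('k \<Rightarrow> 'k \<Rightarrow> complex) \<Rightarrow> ('k \<Rightarrow> 'k) \<Rightarrow> bool" where
  "krein_structure s K f ip J \<longleftrightarrow>
     hermitian_form_on s K f \<and>
     hilbert_space_on s K ip \<and>
     linear_into s K K J \<and>
     (\<forall>x\<in>K. \<forall>y\<in>K. ip (J x) y = ip x (J y)) \<and>
     (\<forall>x\<in>K. J (J x) = x) \<and>
     (\<forall>x\<in>K. \<forall>y\<in>K. f x y = ip (J x) y)"

section \<open>Closable hermitian representations and GNS data\<close>

text \<open>An operator with domain D is closable if the closure of its graph is again the graph of a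
  map.\<close>

definition closable_operator ::
  "'k::ab_group_add set \<Rightarrow> ('k \<Rightarrow> 'k \<Rightarrow> complex) \<Rightarrow> 'k set \<Rightarrow> ('k \<Rightarrow> 'k) \<Rightarrow> bool" where
  "closable_operator K ip D T \<longleftrightarrow>
     single_valued
       (prod_topology (ip_topology K ip) (ip_topology K ip) closure_of ((\<lambda>x. (x, T x)) ` D))"

definition closable_representation ::
  "(complex \<Rightarrow> 'a::ring_1 \<Rightarrow> 'a) \<Rightarrow> (complex \<Rightarrow> 'k::ab_group_add \<Rightarrow> 'k) \<Rightarrow>
   'k set \<Rightarrow> ('k \<Rightarrow> 'k \<Rightarrow> complex) \<Rightarrow> 'k set \<Rightarrow> ('a \<Rightarrow> 'k \<Rightarrow> 'k) \<Rightarrow> bool" where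
  "closable_representation scaleA s K ip D \<pi> \<longleftrightarrow>
     module.subspace s D \<and> D \<subseteq> K \<and> ip_topology K ip closure_of D = K \<and>
     (\<forall>a. linear_into s D D (\<pi> a) \<and> closable_operator K ip D (\<pi> a)) \<and>
     (\<forall>a b. \<forall>x\<in>D. \<pi> (a + b) x = \<pi> a x + \<pi> b x) \<and>
     (\<forall>c a. \<forall>x\<in>D. \<pi> (scaleA c a) x = s c (\<pi> a x)) \<and>
     (\<forall>a b. \<forall>x\<in>D. \<pi> (a * b) x = \<pi> a (\<pi> b x))"

text \<open>Domain and values of the adjoint, with respect to the form f on K, of an operator T with
  dense domain D.\<close>

definition krein_adjoint_domain ::
  "'k set \<Rightarrow> ('k \<Rightarrow> 'k \<Rightarrow> complex) \<Rightarrow> 'k set \<Rightarrow> ('k \<Rightarrow> 'k) \<Rightarrow> 'k set" where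
  "krein_adjoint_domain K f D T = {y \<in> K. \<exists>z\<in>K. \<forall>x\<in>D. f (T x) y = f x z}"

definition krein_adjoint ::
  "'k set \<Rightarrow> ('k \<Rightarrow> 'k \<Rightarrow> complex) \<Rightarrow> 'k set \<Rightarrow> ('k \<Rightarrow> 'k) \<Rightarrow> 'k \<Rightarrow> 'k" where
  "krein_adjoint K f D T y = (THE z. z \<in> K \<and> (\<forall>x\<in>D. f (T x) y = f x z))"

definition hermitian_representation ::
  "('a \<Rightarrow> 'a) \<Rightarrow> 'k set \<Rightarrow> ('k \<Rightarrow> 'k \<Rightarrow> complex) \<Rightarrow> 'k set \<Rightarrow> ('a \<Rightarrow> 'k \<Rightarrow> 'k) \<Rightarrow> bool" where
  "hermitian_representation star K f D \<pi> \<longleftrightarrow>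
     (\<forall>a. D \<subseteq> krein_adjoint_domain K f D (\<pi> a) \<and>
          (\<forall>y\<in>D. krein_adjoint K f D (\<pi> a) y = \<pi> (star a) y))"

text \<open>Density and closability refer to the topology of a positive inner product ip witnessing the
  Krein property; all such inner products on \<open>(K, f)\<close> have equivalent norms, so the choice is
  immaterial and ip, J are not part of the data.\<close>

definition gns_data ::
  "(complex \<Rightarrow> 'a::ring_1 \<Rightarrow> 'a) \<Rightarrow> ('a \<Rightarrow> 'a) \<Rightarrow> ('a \<Rightarrow> complex) \<Rightarrow>
   (complex \<Rightarrow> 'k::ab_group_add \<Rightarrow> 'k) \<Rightarrow> 'k set \<Rightarrow> ('k \<Rightarrow> 'k \<Rightarrow> complex) \<Rightarrow>
   'k set \<Rightarrow> ('a \<Rightarrow> 'k \<Rightarrow> 'k) \<Rightarrow> 'k \<Rightarrow> bool" where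
  "gns_data scaleA star Z s K f D \<pi> \<Omega> \<longleftrightarrow>
     (\<exists>ip J. krein_structure s K f ip J \<and> closable_representation scaleA s K ip D \<pi>) \<and>
     hermitian_representation star K f D \<pi> \<and>
     \<Omega> \<in> D \<and>
     (\<forall>a. Z a = f (\<pi> a \<Omega>) \<Omega>) \<and>
     module.span s (range (\<lambda>a. \<pi> a \<Omega>)) = D"

definition admits_gns_data_in ::
  "(complex \<Rightarrow> 'k::ab_group_add \<Rightarrow> 'k) \<Rightarrow> (complex \<Rightarrow> 'a::ring_1 \<Rightarrow> 'a) \<Rightarrow> ('a \<Rightarrow> 'a) \<Rightarrow>
   ('a \<Rightarrow> complex) \<Rightarrow> bool" where
  "admits_gns_data_in s scaleA star Z \<longleftrightarrow> (\<exists>K f D \<pi> \<Omega>. gns_data scaleA star Z s K f D \<pi> \<Omega>)"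

text \<open>HOL cannot quantify existentially over the type hosting the Krein space. The space of all
  functions from the algebra to the complex numbers, with pointwise operations, hosts every
  possible choice up to isomorphism: since \<open>D\<close> is dense and spanned by the vectors
  \<open>\<pi> a \<Omega>\<close>, the linear map sending \<open>\<xi>\<close> to \<open>\<lambda>a. f \<xi> (\<pi> a \<Omega>)\<close> is injective on K.\<close>

definition admits_gns_data ::
  "(complex \<Rightarrow> 'a::ring_1 \<Rightarrow> 'a) \<Rightarrow> ('a \<Rightarrow> 'a) \<Rightarrow> ('a \<Rightarrow> complex) \<Rightarrow> bool" where
  "admits_gns_data scaleA star Z \<longleftrightarrow>
     admits_gns_data_in (\<lambda>c (g :: 'a \<Rightarrow> complex) x. c * g x) scaleA star Z"

definition dominated_by_kernel ::
  "(complex \<Rightarrow> 'a::ring_1 \<Rightarrow> 'a) \<Rightarrow> ('a \<Rightarrow> 'a) \<Rightarrow> ('a \<Rightarrow> complex) \<Rightarrow> ('a \<Rightarrow> 'a \<Rightarrow> complex) \<Rightarrow>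
   bool" where
  "dominated_by_kernel scaleA star Z L \<longleftrightarrow>
     (\<forall>(n::nat) (l :: nat \<Rightarrow> complex) (x :: nat \<Rightarrow> 'a).
        complex_of_real (cmod (Z (\<Sum>i<n. \<Sum>j<n. scaleA (l i * cnj (l j)) (x i * star (x j)))))
          \<le> (\<Sum>i<n. \<Sum>j<n. l i * cnj (l j) * L (x i) (x j)))"

end

theory Submission
  imports Defs
begin

text \<open>Given GNS data with fundamental symmetry \<open>J\<close>, the kernel \<open>L x y = \<langle>\<pi>(y*)\<Omega>, \<pi>(x*)\<Omega>\<rangle>\<close> dominates
  because \<open>J\<close> is isometric. Conversely, a dominating kernel yields a positive sesquilinear form \<open>q\<close>
  on the algebra with \<open>|B a a| \<le> q a a\<close>, where \<open>B a b = Z(b* a)\<close>. A Krein space completion of \<open>B\<close> is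
  obtained without functional calculus: replace \<open>q\<close> repeatedly by the mean of \<open>q\<close> and the form
  \<open>q* a b = \<langle>B a, B b\<rangle>\<close> computed in the antidual of \<open>q\<close>. The majorants decrease to a majorant with
  \<open>q = q*\<close>, for which the Gram operator of \<open>B\<close> is a symmetry. The Krein space is then the antidual
  of \<open>q\<close> itself, with dense domain the functionals \<open>B a\<close> and \<open>(\<pi>(x) \<phi>) b = \<phi> (x* b)\<close>.\<close>

section \<open>Hermitian and positive forms\<close>

text \<open>Completing the algebra in the \<open>q\<close>-norm does not suffice: the Gram operator
  \<open>G\<close> of \<open>B\<close> is then only a self-adjoint contraction, whereas a Krein
  space requires it to square to the identity. The norm has to shrink until it is the one given by
  \<open>|G|\<close>. Taking the mean with the dual form is Heron's iteration for the square root of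
  \<open>G^2\<close>: for an invertible matrix \<open>q\<close> the dual form is
  \<open>B q^-1 B\<close>, so the step reads \<open>q \<mapsto> (q + B q^-1 B) / 2\<close>. As in
  Heron's method the iterates descend, here because the dual form of a majorant lies below it, and
  at a fixed point the map \<open>a \<mapsto> B a\<close> is isometric into the antidual.

  Antiduals are used because every form in the sequence may be degenerate and the algebra need not
  be complete. Bounded antilinear functionals vanish on null vectors and form a complete space, so
  neither a quotient nor a completion has to be built, and \<open>B q^-1 B\<close> acquires a
  meaning for degenerate \<open>q\<close>. The resulting space already consists of functions on the
  algebra, as \<open>admits_gns_data\<close> asks.\<close>

locale hermitian_form = vector_space s
  for s :: "complex \<Rightarrow> 'k::ab_group_add \<Rightarrow> 'k" +
  fixes K :: "'k set" and f :: "'k \<Rightarrow> 'k \<Rightarrow> complex"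
  assumes subspace_K: "subspace K"
    and hermitian_form_on: "hermitian_form_on s K f"
begin

lemma add_left: "x \<in> K \<Longrightarrow> y \<in> K \<Longrightarrow> z \<in> K \<Longrightarrow> f (x + y) z = f x z + f y z"
  and scale_left: "x \<in> K \<Longrightarrow> y \<in> K \<Longrightarrow> f (s c x) y = c * f x y"
  and form_sym: "x \<in> K \<Longrightarrow> y \<in> K \<Longrightarrow> f x y = cnj (f y x)"
  using hermitian_form_on unfolding hermitian_form_on_def by blast+

lemma closed: "0 \<in> K" "x \<in> K \<Longrightarrow> y \<in> K \<Longrightarrow> x + y \<in> K" "x \<in> K \<Longrightarrow> y \<in> K \<Longrightarrow> x - y \<in> K"
  "x \<in> K \<Longrightarrow> s c x \<in> K"
  using subspace_K by (auto intro: subspace_0 subspace_add subspace_diff subspace_scale)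

lemma diff_left:
  assumes "x \<in> K" "y \<in> K" "z \<in> K" shows "f (x - y) z = f x z - f y z"
proof -
  have "f (x + s (-1) y) z = f x z + (-1) * f y z"
    using assms by (simp only: add_left scale_left closed)
  then show ?thesis by simp
qed

lemma add_right:
  assumes "x \<in> K" "y \<in> K" "z \<in> K" shows "f x (y + z) = f x y + f x z"
  unfolding form_sym[OF assms(1,2)] form_sym[OF assms(1,3)] complex_cnj_add[symmetric]
    add_left[OF assms(2,3,1), symmetric]
  using assms by (intro form_sym closed)

lemma diff_right:
  assumes "x \<in> K" "y \<in> K" "z \<in> K" shows "f x (y - z) = f x y - f x z"
  unfolding form_sym[OF assms(1,2)] form_sym[OF assms(1,3)] complex_cnj_diff[symmetric]
    diff_left[OF assms(2,3,1), symmetric]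
  using assms by (intro form_sym closed)

lemma scale_right:
  assumes "x \<in> K" "y \<in> K" shows "f x (s c y) = cnj c * f x y"
  unfolding form_sym[OF assms] complex_cnj_mult[symmetric] scale_left[OF assms(2,1), symmetric]
  using assms by (intro form_sym closed)

lemma zero_left: "y \<in> K \<Longrightarrow> f 0 y = 0" and zero_right: "y \<in> K \<Longrightarrow> f y 0 = 0"
  using diff_left[of y y y] diff_right[of y y y] by auto

text \<open>Since \<open>f (s \<i> x) y = \<i> * f x y\<close>, the imaginary part of
  \<open>f x y\<close> is minus the real part of \<open>f (s \<i> x) y\<close>, so the real diagonal
  determines the form. Equality and convergence of forms need then be checked on the diagonal
  only.\<close>

lemma polarization:
  assumes "x \<in> K" "y \<in> K"
  shows "f x y = Complex ((Re (f (x + y) (x + y)) - Re (f x x) - Re (f y y)) / 2)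
    (- (Re (f (s \<i> x + y) (s \<i> x + y)) - Re (f (s \<i> x) (s \<i> x)) - Re (f y y)) / 2)"
proof -
  have "Re (f x y) = (Re (f (x + y) (x + y)) - Re (f x x) - Re (f y y)) / 2"
    if "x \<in> K" "y \<in> K" for x y
    using that arg_cong[OF form_sym[of y x], of Re] by (simp add: add_left add_right closed)
  from this[of x y] this[of "s \<i> x" y] show ?thesis
    using assms by (simp add: complex_eq_iff scale_left closed)
qed

lemma form_sum_sum:
  fixes x y :: "nat \<Rightarrow> 'k"
  assumes "\<And>i. x i \<in> K" "\<And>i. y i \<in> K"
  shows "f (\<Sum>i<m. s (c i) (x i)) (\<Sum>j<n. s (d j) (y j)) =
    (\<Sum>i<m. \<Sum>j<n. c i * cnj (d j) * f (x i) (y j))"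
proof -
  have sumK: "(\<Sum>j<k. s (d j) (x j)) \<in> K" if "\<And>i. x i \<in> K" for k d and x :: "nat \<Rightarrow> 'k"
    using that by (intro subspace_sum[OF subspace_K]) (simp add: closed)
  have r: "f v (\<Sum>j<n. s (d j) (y j)) = (\<Sum>j<n. cnj (d j) * f v (y j))" if "v \<in> K" for v
    using that assms by (induction n) (simp_all add: zero_right add_right scale_right closed sumK)
  have l: "f (\<Sum>i<m. s (c i) (x i)) w = (\<Sum>i<m. c i * f (x i) w)" if "w \<in> K" for w
    using that assms by (induction m) (simp_all add: zero_left add_left scale_left closed sumK)
  show ?thesis
    using assms by (subst l) (simp_all add: sumK r sum_distrib_left mult.assoc)
qed

end

text \<open>The common core of the Cauchy-Schwarz inequality and of the density of the representable
  functionals.\<close>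

lemma cmod_sq_le_of_quadratic_nonneg:
  fixes a b :: real
  assumes *: "\<And>c. 0 \<le> a - 2 * Re (cnj c * z) + (cmod c)\<^sup>2 * b" and "0 \<le> b"
  shows "(cmod z)\<^sup>2 \<le> a * b"
proof -
  \<comment> \<open>Choosing \<open>c\<close> with the phase of \<open>z\<close> leaves a quadratic
    in one real variable.\<close>
  have t: "0 \<le> a - 2 * t * (cmod z)\<^sup>2 + t\<^sup>2 * (cmod z)\<^sup>2 * b" for t :: real
  proof -
    have "Re (cnj (of_real t * z) * z) = t * (cmod z)\<^sup>2"
      unfolding cmod_power2 by (simp add: power2_eq_square algebra_simps)
    then show ?thesis
      using *[of "of_real t * z"] by (simp add: norm_mult power_mult_distrib)
  qed
  show ?thesis
  proof (cases "b = 0")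
    case True
    show ?thesis
    proof (cases "z = 0")
      case False
      then show ?thesis
        \<comment> \<open>With \<open>b = 0\<close> the quadratic is affine, and this argument gives
          it the value -1.\<close>
        using t[of "(a + 1) / (2 * (cmod z)\<^sup>2)"] True by (simp add: field_simps)
    qed (use True in simp)
  next
    case False
    then have "0 < b" using assms by simp
    \<comment> \<open>The argument \<open>1 / b\<close> minimizes the quadratic.\<close>
    have "0 \<le> a - (cmod z)\<^sup>2 / b"
      using t[of "1 / b"] \<open>0 < b\<close> by (simp add: field_simps power2_eq_square)
    then show ?thesis using \<open>0 < b\<close> by (simp add: field_simps)
  qed
qed

section \<open>Seminorm and Cauchy-Schwarz inequality of a positive form\<close>

definition form_norm :: "('k \<Rightarrow> 'k \<Rightarrow> complex) \<Rightarrow> 'k \<Rightarrow> real" where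
  "form_norm f x = sqrt (Re (f x x))"

locale positive_form = hermitian_form +
  assumes nonneg: "x \<in> K \<Longrightarrow> 0 \<le> f x x"
begin

lemma Re_form_nonneg: "x \<in> K \<Longrightarrow> 0 \<le> Re (f x x)"
  using nonneg[of x] by (simp add: less_eq_complex_def)

lemma form_norm_nonneg: "x \<in> K \<Longrightarrow> 0 \<le> form_norm f x"
  by (simp add: form_norm_def Re_form_nonneg)

lemma form_norm_sq: "x \<in> K \<Longrightarrow> (form_norm f x)\<^sup>2 = Re (f x x)"
  by (simp add: form_norm_def Re_form_nonneg)

lemma form_same: "x \<in> K \<Longrightarrow> f x x = of_real ((form_norm f x)\<^sup>2)"
  using nonneg[of x] by (simp add: form_norm_sq complex_eq_iff less_eq_complex_def)

lemma quadratic_expand: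
  assumes "x \<in> K" "y \<in> K"
  shows "Re (f (x - s c y) (x - s c y)) = Re (f x x) - 2 * Re (cnj c * f x y) + (cmod c)\<^sup>2 * Re (f y y)"
proof -
  have "f (x - s c y) (x - s c y) = f x x - cnj c * f x y - c * cnj (f x y) + c * cnj c * f y y"
    using assms form_sym[of y x]
    by (simp add: diff_left diff_right scale_left scale_right closed algebra_simps)
  moreover have "Re (c * cnj c * f y y) = (cmod c)\<^sup>2 * Re (f y y)"
    by (metis Re_complex_of_real complex_norm_square form_same[OF assms(2)] of_real_mult)
  ultimately show ?thesis by simp
qed

lemma cauchy_schwarz:
  assumes "x \<in> K" "y \<in> K"
  shows "cmod (f x y) \<le> form_norm f x * form_norm f y"
proof (rule power2_le_imp_le)
  have "(cmod (f x y))\<^sup>2 \<le> Re (f x x) * Re (f y y)"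
  proof (rule cmod_sq_le_of_quadratic_nonneg)
    show "0 \<le> Re (f x x) - 2 * Re (cnj c * f x y) + (cmod c)\<^sup>2 * Re (f y y)" for c
      using Re_form_nonneg[of "x - s c y"] assms by (simp add: quadratic_expand closed)
  qed (use assms in \<open>simp add: Re_form_nonneg\<close>)
  then show "(cmod (f x y))\<^sup>2 \<le> (form_norm f x * form_norm f y)\<^sup>2"
    using assms by (simp add: power_mult_distrib form_norm_sq)
qed (use assms in \<open>simp add: form_norm_nonneg\<close>)

lemma form_norm_add:
  assumes "x \<in> K" "y \<in> K"
  shows "form_norm f (x + y) \<le> form_norm f x + form_norm f y"
proof (rule power2_le_imp_le)
  have "Re (f (x + y) (x + y)) = Re (f x x) + 2 * Re (f x y) + Re (f y y)"
    using assms arg_cong[OF form_sym[of y x], of Re] by (simp add: add_left add_right closed)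
  also have "Re (f x y) \<le> form_norm f x * form_norm f y"
    using cauchy_schwarz[OF assms] complex_Re_le_cmod order_trans by blast
  finally show "(form_norm f (x + y))\<^sup>2 \<le> (form_norm f x + form_norm f y)\<^sup>2"
    using assms by (simp add: form_norm_sq closed power2_sum)
qed (use assms in \<open>simp add: form_norm_nonneg\<close>)

lemma form_norm_scale: "x \<in> K \<Longrightarrow> form_norm f (s c x) = cmod c * form_norm f x"
proof -
  assume x: "x \<in> K"
  have "Re (f (s c x) (s c x)) = (cmod c)\<^sup>2 * Re (f x x)"
    using quadratic_expand[of 0 x "- c"] x by (simp add: zero_left closed diff_left diff_right zero_right)
  then show ?thesis by (simp add: form_norm_def real_sqrt_mult)
qed

lemma form_norm_uminus: "x \<in> K \<Longrightarrow> form_norm f (- x) = form_norm f x"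
  using form_norm_scale[of x "-1"] by simp

lemma form_norm_minus_commute: "x \<in> K \<Longrightarrow> y \<in> K \<Longrightarrow> form_norm f (x - y) = form_norm f (y - x)"
  using form_norm_uminus[of "x - y"] closed by simp

lemma form_norm_zero: "form_norm f 0 = 0"
  by (simp add: form_norm_def zero_left closed)

lemma ip_dist_eq: "x \<in> K \<Longrightarrow> y \<in> K \<Longrightarrow> ip_dist K f x y = form_norm f (x - y)"
  by (simp add: ip_dist_def form_norm_def)

lemma Metric_space_ip_dist:
  assumes "\<And>x. x \<in> K \<Longrightarrow> f x x = 0 \<Longrightarrow> x = 0"
  shows "Metric_space K (ip_dist K f)"
proof
  show "0 \<le> ip_dist K f x y" for x y
    by (simp add: ip_dist_def Re_form_nonneg closed)
  show "ip_dist K f x y = ip_dist K f y x" for x y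
    using ip_dist_eq form_norm_minus_commute by (cases "x \<in> K \<and> y \<in> K") (auto simp: ip_dist_def)
  show "ip_dist K f x y = 0 \<longleftrightarrow> x = y" if "x \<in> K" "y \<in> K" for x y
    using that assms[of "x - y"] form_same[of "x - y"]
    by (auto simp: ip_dist_eq closed form_norm_zero)
  show "ip_dist K f x z \<le> ip_dist K f x y + ip_dist K f y z" if "x \<in> K" "y \<in> K" "z \<in> K" for x y z
    using that form_norm_add[of "x - y" "y - z"] by (simp add: ip_dist_eq closed)
qed

end

lemma hermitian_form_eqI:
  assumes "hermitian_form s K f" "hermitian_form s K g"
    and "\<And>x. x \<in> K \<Longrightarrow> Re (f x x) = Re (g x x)" and "x \<in> K" "y \<in> K"
  shows "f x y = g x y"
  unfolding hermitian_form.polarization[OF assms(1,4,5)] hermitian_form.polarization[OF assms(2,4,5)]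
  using assms by (simp add: hermitian_form.closed[OF assms(1)])

section \<open>The Hilbert space of bounded antilinear functionals\<close>

text \<open>The constant stays explicit because the norm of the dual becomes available only later,
  when it turns out to be the least such constant. The condition \<open>0 \<le> C\<close> is
  separate since the seminorm may vanish identically.\<close>

definition bounded_by :: "('a \<Rightarrow> 'a \<Rightarrow> complex) \<Rightarrow> ('a \<Rightarrow> complex) \<Rightarrow> real \<Rightarrow> bool" where
  "bounded_by q \<phi> C \<longleftrightarrow> 0 \<le> C \<and> (\<forall>b. cmod (\<phi> b) \<le> C * form_norm q b)"

text \<open>Antilinear rather than linear, so that \<open>q a\<close> itself is a member and
  \<open>a \<mapsto> q a\<close> is linear.\<close>

definition dual_space ::
  "(complex \<Rightarrow> 'a::ab_group_add \<Rightarrow> 'a) \<Rightarrow> ('a \<Rightarrow> 'a \<Rightarrow> complex) \<Rightarrow> ('a \<Rightarrow> complex) set" where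
  "dual_space s q = {\<phi>. (\<forall>x y. \<phi> (x + y) = \<phi> x + \<phi> y) \<and> (\<forall>c x. \<phi> (s c x) = cnj c * \<phi> x) \<and>
     (\<exists>C. bounded_by q \<phi> C)}"

text \<open>Determined by the reproducing property \<open>dual_ip q (q a) \<psi> = cnj (\<psi> a)\<close> together with
  continuity, since the functionals \<open>q a\<close> are dense.\<close>

definition dual_ip ::
  "('a \<Rightarrow> 'a \<Rightarrow> complex) \<Rightarrow> ('a \<Rightarrow> complex) \<Rightarrow> ('a \<Rightarrow> complex) \<Rightarrow> complex" where
  "dual_ip q \<phi> \<psi> = (THE z. \<forall>a e C. bounded_by q (\<lambda>b. \<phi> b - q a b) e \<longrightarrow> bounded_by q \<psi> C \<longrightarrow>
     cmod (z - cnj (\<psi> a)) \<le> C * e)"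

abbreviation fun_scale :: "complex \<Rightarrow> ('a \<Rightarrow> complex) \<Rightarrow> 'a \<Rightarrow> complex" where
  "fun_scale \<equiv> \<lambda>c g x. c * g x"

lemma vector_space_fun_scale: "vector_space fun_scale"
  by unfold_locales (auto simp: fun_eq_iff algebra_simps)

locale semi_inner_product = positive_form s UNIV q
  for s :: "complex \<Rightarrow> 'a::ab_group_add \<Rightarrow> 'a" and q
begin

abbreviation dual (\<open>H\<close>) where "dual \<equiv> dual_space s q"

lemma bounded_by_form: "bounded_by q (q a) (form_norm q a)"
  by (simp add: bounded_by_def form_norm_nonneg cauchy_schwarz)

text \<open>Evaluate the bound at \<open>a\<close> itself. Together with
  \<open>bounded_by_form\<close> this says that \<open>a \<mapsto> q a\<close> preserves
  norms.\<close>

lemma form_norm_le: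
  assumes "bounded_by q (q a) C" shows "form_norm q a \<le> C"
proof (cases "form_norm q a = 0")
  case False
  have "form_norm q a * form_norm q a \<le> C * form_norm q a"
    using assms form_same[of a] unfolding bounded_by_def
    by (metis UNIV_I abs_of_nonneg norm_of_real power2_eq_square zero_le_power2)
  moreover have "0 < form_norm q a" using False form_norm_nonneg[of a] by simp
  ultimately show ?thesis by simp
qed (use assms in \<open>simp add: bounded_by_def\<close>)

lemma bounded_by_add:
  "bounded_by q \<phi> C \<Longrightarrow> bounded_by q \<psi> D \<Longrightarrow> bounded_by q (\<lambda>b. \<phi> b + \<psi> b) (C + D)"
  unfolding bounded_by_def
  by (auto simp: distrib_right intro: order_trans[OF norm_triangle_ineq add_mono])

lemma bounded_by_scale: "bounded_by q \<phi> C \<Longrightarrow> bounded_by q (\<lambda>b. c * \<phi> b) (cmod c * C)"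
  unfolding bounded_by_def by (auto simp: norm_mult mult.assoc intro!: mult_left_mono)

lemma bounded_by_diff:
  assumes "bounded_by q \<phi> C" "bounded_by q \<psi> D" shows "bounded_by q (\<lambda>b. \<phi> b - \<psi> b) (C + D)"
  using bounded_by_add[OF assms(1) bounded_by_scale[OF assms(2), of "-1"]] by simp

lemma dual_memI:
  assumes "\<And>x y. \<phi> (x + y) = \<phi> x + \<phi> y" "\<And>c x. \<phi> (s c x) = cnj c * \<phi> x" "bounded_by q \<phi> C"
  shows "\<phi> \<in> H"
  using assms by (auto simp: dual_space_def)

lemma dual_add: "\<phi> \<in> H \<Longrightarrow> \<phi> (x + y) = \<phi> x + \<phi> y"
  and dual_scale: "\<phi> \<in> H \<Longrightarrow> \<phi> (s c x) = cnj c * \<phi> x"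
  and dual_bounded: "\<phi> \<in> H \<Longrightarrow> \<exists>C. bounded_by q \<phi> C"
  by (auto simp: dual_space_def)

lemma dual_diff: "\<phi> \<in> H \<Longrightarrow> \<phi> (x - y) = \<phi> x - \<phi> y"
  using dual_add[of \<phi> x "s (-1) y"] dual_scale[of \<phi> "-1" y] by simp

lemma form_mem_dual: "q a \<in> H"
  by (rule dual_memI[OF _ _ bounded_by_form]) (simp_all add: add_right scale_right)

lemma subspace_dual: "module.subspace fun_scale H"
proof -
  interpret F: vector_space fun_scale by (rule vector_space_fun_scale)
  show ?thesis
  proof (rule F.subspaceI)
    have "bounded_by q 0 0" by (simp add: bounded_by_def)
    then show "0 \<in> H" by (rule dual_memI[rotated 2]) auto
    show "\<phi> + \<psi> \<in> H" if mem: "\<phi> \<in> H" "\<psi> \<in> H" for \<phi> \<psi>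
    proof -
      obtain C D where "bounded_by q \<phi> C" "bounded_by q \<psi> D"
        using mem by (meson dual_bounded)
      then have "bounded_by q (\<phi> + \<psi>) (C + D)"
        unfolding plus_fun_def by (rule bounded_by_add)
      then show ?thesis
        using that by (intro dual_memI) (simp_all add: dual_add dual_scale algebra_simps)
    qed
    show "fun_scale c \<phi> \<in> H" if "\<phi> \<in> H" for c \<phi>
    proof -
      obtain C where "bounded_by q \<phi> C" using \<open>\<phi> \<in> H\<close> dual_bounded by blast
      then have "bounded_by q (fun_scale c \<phi>) (cmod c * C)" by (rule bounded_by_scale)
      then show ?thesis
        using \<open>\<phi> \<in> H\<close> by (intro dual_memI) (simp_all add: dual_add dual_scale algebra_simps)
    qed
  qed
qed

text \<open>An almost minimizer \<open>a\<close> of \<open>q a a - 2 Re (\<phi> a)\<close> almost represents \<open>\<phi>\<close>.\<close>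

lemma dual_dense:
  assumes "\<phi> \<in> H" "0 < \<epsilon>"
  obtains a where "bounded_by q (\<lambda>b. \<phi> b - q a b) \<epsilon>"
proof -
  define F where "F a = Re (q a a) - 2 * Re (\<phi> a)" for a
  obtain C where C: "bounded_by q \<phi> C" using assms dual_bounded by blast
  \<comment> \<open>Completing the square in \<open>form_norm q a\<close>.\<close>
  have below: "- C\<^sup>2 \<le> F a" for a
  proof -
    have "Re (\<phi> a) \<le> C * form_norm q a"
      using C complex_Re_le_cmod order_trans unfolding bounded_by_def by blast
    moreover have "0 \<le> (form_norm q a - C)\<^sup>2" by simp
    ultimately show ?thesis
      using form_norm_sq[of a] by (simp add: F_def power2_diff algebra_simps)
  qed
  then have bdd: "bdd_below (range F)" by (intro bdd_belowI2) auto
  \<comment> \<open>The slack is \<open>\<epsilon>\<^sup>2\<close> because the quadratic inequality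
    below bounds the square of the error: moving from \<open>a\<close> to \<open>a - s c b\<close>
    cannot lower \<open>F\<close> by more than the slack.\<close>
  have "\<exists>a. F a < (INF a. F a) + \<epsilon>\<^sup>2"
    using cInf_less_iff[OF _ bdd, of "(INF a. F a) + \<epsilon>\<^sup>2"] \<open>0 < \<epsilon>\<close> by auto
  then obtain a where a: "F a < (INF a. F a) + \<epsilon>\<^sup>2" ..
  have "(cmod (q a b - \<phi> b))\<^sup>2 \<le> \<epsilon>\<^sup>2 * Re (q b b)" for b
  proof (rule cmod_sq_le_of_quadratic_nonneg)
    fix c
    have "F a \<le> F (a - s c b) + \<epsilon>\<^sup>2"
      using a cINF_lower[OF bdd, of "a - s c b"] by simp
    moreover have "F (a - s c b) = F a - 2 * Re (cnj c * (q a b - \<phi> b)) + (cmod c)\<^sup>2 * Re (q b b)"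
      using assms by (simp add: F_def quadratic_expand dual_diff dual_scale right_diff_distrib)
    ultimately show "0 \<le> \<epsilon>\<^sup>2 - 2 * Re (cnj c * (q a b - \<phi> b)) + (cmod c)\<^sup>2 * Re (q b b)"
      by simp
  qed (simp add: Re_form_nonneg)
  then have "(cmod (\<phi> b - q a b))\<^sup>2 \<le> (\<epsilon> * form_norm q b)\<^sup>2" for b
    by (simp add: norm_minus_commute power_mult_distrib form_norm_sq)
  then have "bounded_by q (\<lambda>b. \<phi> b - q a b) \<epsilon>"
    using \<open>0 < \<epsilon>\<close> form_norm_nonneg unfolding bounded_by_def
    by (metis UNIV_I less_eq_real_def mult_nonneg_nonneg power2_le_imp_le)
  then show thesis ..
qed

lemma approx_close:
  assumes "bounded_by q (\<lambda>b. \<phi> b - q a b) e" "bounded_by q (\<lambda>b. \<phi> b - q a' b) e'"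
  shows "form_norm q (a - a') \<le> e + e'"
proof (rule form_norm_le)
  have "(\<lambda>b. (\<phi> b - q a' b) - (\<phi> b - q a b)) = q (a - a')"
    by (simp add: diff_left fun_eq_iff)
  then show "bounded_by q (q (a - a')) (e + e')"
    using bounded_by_diff[OF assms(2,1)] by (simp add: add.commute)
qed

section \<open>Approximating sequences and the inner product of the antidual\<close>

definition approx :: "('a \<Rightarrow> complex) \<Rightarrow> (nat \<Rightarrow> 'a) \<Rightarrow> bool" where
  "approx \<phi> a \<longleftrightarrow> (\<exists>e. e \<longlonglongrightarrow> 0 \<and> (\<forall>n. bounded_by q (\<lambda>b. \<phi> b - q (a n) b) (e n)))"

lemma approx_exists:
  assumes "\<phi> \<in> H" obtains a where "approx \<phi> a"
proof -
  have "\<exists>a. bounded_by q (\<lambda>b. \<phi> b - q a b) (1 / real (Suc n))" for n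
    by (rule dual_dense[OF assms, of "1 / real (Suc n)"]) auto
  then obtain a where "\<And>n. bounded_by q (\<lambda>b. \<phi> b - q (a n) b) (1 / real (Suc n))" by metis
  moreover have "(\<lambda>n. 1 / real (Suc n)) \<longlonglongrightarrow> 0" by (rule LIMSEQ_Suc[OF lim_1_over_n])
  ultimately have "approx \<phi> a" unfolding approx_def by blast
  then show thesis ..
qed

text \<open>The description in \<open>dual_ip\<close> has exactly one solution. Along approximants
  \<open>\<alpha> n\<close> of \<open>\<phi>\<close> the numbers
  \<open>cnj (\<psi> (\<alpha> n))\<close> form a Cauchy sequence by \<open>approx_close\<close>;
  their limit satisfies every required estimate, and any other solution is also a limit of that
  sequence.\<close>

lemma dual_ip_bound:
  assumes \<phi>: "\<phi> \<in> H" and \<psi>: "\<psi> \<in> H"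
    and "bounded_by q (\<lambda>b. \<phi> b - q a b) e" "bounded_by q \<psi> C"
  shows "cmod (dual_ip q \<phi> \<psi> - cnj (\<psi> a)) \<le> C * e"
proof -
  let ?P = "\<lambda>z. \<forall>a e C. bounded_by q (\<lambda>b. \<phi> b - q a b) e \<longrightarrow> bounded_by q \<psi> C \<longrightarrow>
     cmod (z - cnj (\<psi> a)) \<le> C * e"
  obtain \<alpha> \<epsilon> where \<epsilon>: "\<epsilon> \<longlonglongrightarrow> 0" and \<alpha>: "\<And>n. bounded_by q (\<lambda>b. \<phi> b - q (\<alpha> n) b) (\<epsilon> n)"
    using approx_exists[OF \<phi>] unfolding approx_def by metis
  have diff: "cmod (cnj (\<psi> a) - cnj (\<psi> a')) \<le> C * (e + e')"
    if "bounded_by q (\<lambda>b. \<phi> b - q a b) e" "bounded_by q (\<lambda>b. \<phi> b - q a' b) e'"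
      "bounded_by q \<psi> C" for a a' e e' C
  proof -
    have "cmod (cnj (\<psi> a) - cnj (\<psi> a')) = cmod (\<psi> (a - a'))"
      using \<psi> by (metis complex_cnj_diff complex_mod_cnj dual_diff)
    also have "\<dots> \<le> C * form_norm q (a - a')" using that by (simp add: bounded_by_def)
    also have "\<dots> \<le> C * (e + e')"
      using approx_close[OF that(1,2)] that(3) by (simp add: bounded_by_def mult_left_mono)
    finally show ?thesis .
  qed
  obtain D where D: "bounded_by q \<psi> D" using \<psi> dual_bounded by blast
  have "Cauchy (\<lambda>n. cnj (\<psi> (\<alpha> n)))"
  proof (rule metric_CauchyI)
    fix \<delta> :: real assume "0 < \<delta>"
    have "(\<lambda>n. D * \<epsilon> n) \<longlonglongrightarrow> 0" using tendsto_mult_left[OF \<epsilon>, of D] by simp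
    then have "eventually (\<lambda>n. D * \<epsilon> n < \<delta> / 2) sequentially"
      by (rule order_tendstoD) (use \<open>0 < \<delta>\<close> in simp)
    then obtain M where M: "\<And>n. M \<le> n \<Longrightarrow> D * \<epsilon> n < \<delta> / 2"
      by (auto simp: eventually_sequentially)
    have "dist (cnj (\<psi> (\<alpha> m))) (cnj (\<psi> (\<alpha> n))) < \<delta>" if "M \<le> m" "M \<le> n" for m n
      using diff[OF \<alpha>[of m] \<alpha>[of n] D] M[OF that(1)] M[OF that(2)]
      by (simp add: dist_norm distrib_left)
    then show "\<exists>M. \<forall>m\<ge>M. \<forall>n\<ge>M. dist (cnj (\<psi> (\<alpha> m))) (cnj (\<psi> (\<alpha> n))) < \<delta>" by blast
  qed
  then obtain z where z: "(\<lambda>n. cnj (\<psi> (\<alpha> n))) \<longlonglongrightarrow> z"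
    using Cauchy_convergent_iff convergent_def by blast
  have "?P z"
  proof (intro allI impI)
    fix a e C assume *: "bounded_by q (\<lambda>b. \<phi> b - q a b) e" "bounded_by q \<psi> C"
    have "(\<lambda>n. cmod (cnj (\<psi> (\<alpha> n)) - cnj (\<psi> a))) \<longlonglongrightarrow> cmod (z - cnj (\<psi> a))"
      by (intro tendsto_intros z)
    moreover have "(\<lambda>n. C * (\<epsilon> n + e)) \<longlonglongrightarrow> C * (0 + e)" by (intro tendsto_intros \<epsilon>)
    ultimately have "cmod (z - cnj (\<psi> a)) \<le> C * (0 + e)"
      by (rule LIMSEQ_le) (use diff[OF \<alpha> *] in blast)
    then show "cmod (z - cnj (\<psi> a)) \<le> C * e" by simp
  qed
  moreover have "w = z" if "?P w" for w
  proof -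
    have "(\<lambda>n. cnj (\<psi> (\<alpha> n)) - w) \<longlonglongrightarrow> 0"
    proof (rule Lim_null_comparison)
      show "\<forall>\<^sub>F n in sequentially. cmod (cnj (\<psi> (\<alpha> n)) - w) \<le> D * \<epsilon> n"
        using that \<alpha> D by (intro always_eventually allI) (metis norm_minus_commute)
      show "(\<lambda>n. D * \<epsilon> n) \<longlonglongrightarrow> 0" using tendsto_mult_left[OF \<epsilon>, of D] by simp
    qed
    then show ?thesis by (rule LIMSEQ_unique[OF LIM_zero_cancel z])
  qed
  ultimately have "?P (dual_ip q \<phi> \<psi>)"
    unfolding dual_ip_def by (rule theI)
  from this[rule_format, OF assms(3,4)] show ?thesis .
qed

lemma dual_ip_tendsto:
  assumes "\<phi> \<in> H" "\<psi> \<in> H" "approx \<phi> a"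
  shows "(\<lambda>n. cnj (\<psi> (a n))) \<longlonglongrightarrow> dual_ip q \<phi> \<psi>"
proof -
  obtain e where e: "e \<longlonglongrightarrow> 0" "\<And>n. bounded_by q (\<lambda>b. \<phi> b - q (a n) b) (e n)"
    using assms unfolding approx_def by blast
  obtain C where C: "bounded_by q \<psi> C" using assms dual_bounded by blast
  have "(\<lambda>n. cnj (\<psi> (a n)) - dual_ip q \<phi> \<psi>) \<longlonglongrightarrow> 0"
  proof (rule Lim_null_comparison)
    show "\<forall>\<^sub>F n in sequentially. cmod (cnj (\<psi> (a n)) - dual_ip q \<phi> \<psi>) \<le> C * e n"
      using dual_ip_bound[OF assms(1,2) e(2) C] by (simp add: norm_minus_commute)
    show "(\<lambda>n. C * e n) \<longlonglongrightarrow> 0" using tendsto_mult_left[OF e(1), of C] by simp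
  qed
  then show ?thesis by (rule LIM_zero_cancel)
qed

lemma dual_ip_form:
  assumes "\<psi> \<in> H" shows "dual_ip q (q a) \<psi> = cnj (\<psi> a)"
proof -
  have "approx (q a) (\<lambda>n. a)"
    unfolding approx_def by (rule exI[of _ "\<lambda>n. 0"]) (simp add: bounded_by_def)
  from dual_ip_tendsto[OF form_mem_dual assms this] show ?thesis
    by (simp add: LIMSEQ_const_iff)
qed

text \<open>The error is a null sequence times the norm of \<open>b n\<close>, which stays bounded
  because \<open>q (b n)\<close> is close to the bounded functional \<open>\<psi>\<close>.\<close>

lemma approx_diff_tendsto:
  assumes "\<phi> \<in> H" "approx \<phi> a" "\<psi> \<in> H" "approx \<psi> b"
  shows "(\<lambda>n. \<phi> (b n) - q (a n) (b n)) \<longlonglongrightarrow> 0"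
proof -
  obtain e where e: "e \<longlonglongrightarrow> 0" "\<And>n. bounded_by q (\<lambda>b. \<phi> b - q (a n) b) (e n)"
    using assms unfolding approx_def by blast
  obtain d where d: "d \<longlonglongrightarrow> 0" "\<And>n. bounded_by q (\<lambda>x. \<psi> x - q (b n) x) (d n)"
    using assms unfolding approx_def by blast
  obtain C where C: "bounded_by q \<psi> C" using assms dual_bounded by blast
  have norm_b: "form_norm q (b n) \<le> C + d n" for n
    using bounded_by_diff[OF C d(2)] by (intro form_norm_le) simp
  show ?thesis
  proof (rule Lim_null_comparison)
    show "\<forall>\<^sub>F n in sequentially. cmod (\<phi> (b n) - q (a n) (b n)) \<le> e n * (C + d n)"
      using e(2) norm_b unfolding bounded_by_def
      by (intro always_eventually allI) (meson mult_left_mono order_trans)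
    have "(\<lambda>n. e n * (C + d n)) \<longlonglongrightarrow> 0 * (C + 0)" by (intro tendsto_intros e d)
    then show "(\<lambda>n. e n * (C + d n)) \<longlonglongrightarrow> 0" by simp
  qed
qed

text \<open>Approximating both arguments gives a description symmetric in \<open>\<phi>\<close> and
  \<open>\<psi>\<close>, through which symmetry and positivity are inherited from
  \<open>q\<close>.\<close>

lemma approx_form_tendsto:
  assumes "\<phi> \<in> H" "approx \<phi> a" "\<psi> \<in> H" "approx \<psi> b"
  shows "(\<lambda>n. q (a n) (b n)) \<longlonglongrightarrow> dual_ip q \<phi> \<psi>"
proof -
  have "(\<lambda>n. cnj (\<psi> (a n) - q (b n) (a n))) \<longlonglongrightarrow> cnj 0"
    by (rule tendsto_cnj) (rule approx_diff_tendsto[OF assms(3,4,1,2)])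
  then have "(\<lambda>n. cnj (\<psi> (a n)) - q (a n) (b n)) \<longlonglongrightarrow> 0"
    using form_sym[OF UNIV_I UNIV_I, symmetric] by simp
  from tendsto_diff[OF dual_ip_tendsto[OF assms(1,3,2)] this] show ?thesis by simp
qed

lemma approx_add:
  assumes "approx \<phi> a" "approx \<psi> b" shows "approx (\<phi> + \<psi>) (\<lambda>n. a n + b n)"
proof -
  obtain e where e: "e \<longlonglongrightarrow> 0" "\<And>n. bounded_by q (\<lambda>b. \<phi> b - q (a n) b) (e n)"
    using assms unfolding approx_def by blast
  obtain d where d: "d \<longlonglongrightarrow> 0" "\<And>n. bounded_by q (\<lambda>x. \<psi> x - q (b n) x) (d n)"
    using assms unfolding approx_def by blast
  show ?thesis
    unfolding approx_def
    using bounded_by_add[OF e(2) d(2)] tendsto_add[OF e(1) d(1)]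
    by (intro exI[of _ "\<lambda>n. e n + d n"]) (simp add: add_left algebra_simps)
qed

lemma approx_scale:
  assumes "approx \<phi> a" shows "approx (fun_scale c \<phi>) (\<lambda>n. s c (a n))"
proof -
  obtain e where e: "e \<longlonglongrightarrow> 0" "\<And>n. bounded_by q (\<lambda>b. \<phi> b - q (a n) b) (e n)"
    using assms unfolding approx_def by blast
  show ?thesis
    unfolding approx_def
    using bounded_by_scale[OF e(2), of c] tendsto_mult_left[OF e(1), of "cmod c"]
    by (intro exI[of _ "\<lambda>n. cmod c * e n"]) (simp add: scale_left algebra_simps)
qed

text \<open>Linearity passes through the one-sided limit \<open>cnj (\<eta> (a n))\<close>;
  hermitian symmetry and positivity need the two-sided limit \<open>q (a n) (b n)\<close>.\<close>

sublocale dual: positive_form fun_scale H "dual_ip q"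
proof -
  interpret F: vector_space fun_scale by (rule vector_space_fun_scale)
  note closed = F.subspace_add[OF subspace_dual] F.subspace_scale[OF subspace_dual]
  show "positive_form fun_scale H (dual_ip q)"
  proof unfold_locales
    show "F.subspace H" by (rule subspace_dual)
    have "dual_ip q (\<phi> + \<psi>) \<eta> = dual_ip q \<phi> \<eta> + dual_ip q \<psi> \<eta>"
      if mem: "\<phi> \<in> H" "\<psi> \<in> H" "\<eta> \<in> H" for \<phi> \<psi> \<eta>
    proof -
      obtain a b where ab: "approx \<phi> a" "approx \<psi> b" using mem by (meson approx_exists)
      have "(\<lambda>n. cnj (\<eta> (a n + b n))) \<longlonglongrightarrow> dual_ip q (\<phi> + \<psi>) \<eta>"
        using that by (intro dual_ip_tendsto approx_add ab closed)
      moreover have "(\<lambda>n. cnj (\<eta> (a n)) + cnj (\<eta> (b n))) \<longlonglongrightarrow> dual_ip q \<phi> \<eta> + dual_ip q \<psi> \<eta>"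
        using that by (intro tendsto_add dual_ip_tendsto ab)
      ultimately show ?thesis
        using that by (auto simp: dual_add intro: LIMSEQ_unique)
    qed
    moreover have "dual_ip q (fun_scale c \<phi>) \<psi> = c * dual_ip q \<phi> \<psi>"
      if mem: "\<phi> \<in> H" "\<psi> \<in> H" for c \<phi> \<psi>
    proof -
      obtain a where a: "approx \<phi> a" using mem by (meson approx_exists)
      have "(\<lambda>n. cnj (\<psi> (s c (a n)))) \<longlonglongrightarrow> dual_ip q (fun_scale c \<phi>) \<psi>"
        using that by (intro dual_ip_tendsto approx_scale a closed)
      moreover have "(\<lambda>n. c * cnj (\<psi> (a n))) \<longlonglongrightarrow> c * dual_ip q \<phi> \<psi>"
        using that by (intro tendsto_mult_left dual_ip_tendsto a)
      ultimately show ?thesis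
        using that by (auto simp: dual_scale intro: LIMSEQ_unique)
    qed
    moreover have "dual_ip q \<phi> \<psi> = cnj (dual_ip q \<psi> \<phi>)" if mem: "\<phi> \<in> H" "\<psi> \<in> H" for \<phi> \<psi>
    proof -
      obtain a b where ab: "approx \<phi> a" "approx \<psi> b" using mem by (meson approx_exists)
      have "(\<lambda>n. cnj (q (b n) (a n))) \<longlonglongrightarrow> cnj (dual_ip q \<psi> \<phi>)"
        using that by (intro tendsto_cnj approx_form_tendsto ab)
      then have "(\<lambda>n. q (a n) (b n)) \<longlonglongrightarrow> cnj (dual_ip q \<psi> \<phi>)"
        using form_sym[OF UNIV_I UNIV_I, symmetric] by simp
      then show ?thesis
        using approx_form_tendsto[of \<phi> a \<psi> b] ab that LIMSEQ_unique by blast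
    qed
    ultimately show "hermitian_form_on fun_scale H (dual_ip q)"
      unfolding hermitian_form_on_def by blast
    show "0 \<le> dual_ip q \<phi> \<phi>" if mem: "\<phi> \<in> H" for \<phi>
    proof -
      obtain a where a: "approx \<phi> a" using mem by (meson approx_exists)
      have lim: "(\<lambda>n. q (a n) (a n)) \<longlonglongrightarrow> dual_ip q \<phi> \<phi>"
        using that by (intro approx_form_tendsto a)
      have "0 \<le> Re (dual_ip q \<phi> \<phi>)"
        by (rule LIMSEQ_le_const[OF tendsto_Re[OF lim]]) (simp add: Re_form_nonneg)
      moreover have "Im (dual_ip q \<phi> \<phi>) = 0"
        using tendsto_Im[OF lim] form_same by (simp add: LIMSEQ_const_iff)
      ultimately show ?thesis by (simp add: less_eq_complex_def)
    qed
  qed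
qed

section \<open>Norm, definiteness and completeness of the antidual\<close>

lemma dual_ip_form_right:
  assumes "\<phi> \<in> H" shows "dual_ip q \<phi> (q a) = \<phi> a"
  unfolding dual.form_sym[OF assms form_mem_dual] dual_ip_form[OF assms] by simp

text \<open>Cauchy-Schwarz in the dual against \<open>q b\<close>, whose dual norm is
  \<open>form_norm q b\<close>.\<close>

lemma bounded_by_dual_norm:
  assumes "\<phi> \<in> H" shows "bounded_by q \<phi> (form_norm (dual_ip q) \<phi>)"
  unfolding bounded_by_def
proof (intro conjI allI)
  show "0 \<le> form_norm (dual_ip q) \<phi>" using assms by (rule dual.form_norm_nonneg)
  show "cmod (\<phi> b) \<le> form_norm (dual_ip q) \<phi> * form_norm q b" for b
    using dual.cauchy_schwarz[OF form_mem_dual assms, of b] dual_ip_form[OF form_mem_dual]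
    by (simp add: dual_ip_form[OF assms] mult.commute form_norm_def)
qed

text \<open>Test the bound on approximants of \<open>\<phi>\<close>: in the limit it reads
  \<open>?N * ?N \<le> C * ?N\<close>, and one factor cancels.\<close>

lemma dual_norm_le:
  assumes "\<phi> \<in> H" "bounded_by q \<phi> C" shows "form_norm (dual_ip q) \<phi> \<le> C"
proof -
  let ?N = "form_norm (dual_ip q) \<phi>"
  obtain a where a: "approx \<phi> a" using assms approx_exists by metis
  have "(\<lambda>n. q (a n) (a n)) \<longlonglongrightarrow> dual_ip q \<phi> \<phi>"
    using assms by (intro approx_form_tendsto a)
  then have "(\<lambda>n. form_norm q (a n)) \<longlonglongrightarrow> ?N"
    unfolding form_norm_def by (intro tendsto_intros)
  then have "(\<lambda>n. C * form_norm q (a n)) \<longlonglongrightarrow> C * ?N" by (rule tendsto_mult_left)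
  with tendsto_norm[OF dual_ip_tendsto[OF assms(1) assms(1) a]]
  have "cmod (dual_ip q \<phi> \<phi>) \<le> C * ?N"
    by (rule LIMSEQ_le) (use assms in \<open>simp add: bounded_by_def\<close>)
  moreover have "cmod (dual_ip q \<phi> \<phi>) = ?N * ?N"
    using dual.form_same[OF assms(1)] dual.form_norm_nonneg[OF assms(1)]
    by (simp add: norm_mult power2_eq_square)
  ultimately show ?thesis
    using dual.form_norm_nonneg[OF assms(1)] assms(2)
    by (cases "?N = 0") (auto simp: bounded_by_def)
qed

text \<open>A functional of norm zero has all its values bounded by zero. This holds even for
  degenerate \<open>q\<close>, which is why no quotient is taken.\<close>

lemma dual_ip_definite:
  assumes "\<phi> \<in> H" "dual_ip q \<phi> \<phi> = 0" shows "\<phi> = 0"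
  using bounded_by_dual_norm[OF assms(1)] assms(2)
  by (simp add: bounded_by_def form_norm_def fun_eq_iff)

lemma Metric_space_dual: "Metric_space H (ip_dist H (dual_ip q))"
  by (rule dual.Metric_space_ip_dist) (rule dual_ip_definite)

lemma dual_norm_dense:
  assumes "\<phi> \<in> H" "0 < \<epsilon>"
  obtains a where "form_norm (dual_ip q) (\<phi> - q a) \<le> \<epsilon>"
proof -
  obtain a where "bounded_by q (\<lambda>b. \<phi> b - q a b) \<epsilon>" by (rule dual_dense[OF assms])
  then have "form_norm (dual_ip q) (\<phi> - q a) \<le> \<epsilon>"
    using assms form_mem_dual by (intro dual_norm_le dual.closed) (simp_all add: fun_diff_def)
  then show thesis ..
qed

lemma hilbert_space_dual: "hilbert_space_on fun_scale H (dual_ip q)"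
  unfolding hilbert_space_on_def
proof (intro conjI ballI impI)
  interpret M: Metric_space H "ip_dist H (dual_ip q)" by (rule Metric_space_dual)
  show "M.mcomplete"
    unfolding M.mcomplete_def
  proof (intro allI impI)
    fix \<sigma> assume \<sigma>: "M.MCauchy \<sigma>"
    then have mem: "\<sigma> n \<in> H" for n unfolding M.MCauchy_def by blast
    have ev: "\<exists>N. \<forall>n\<ge>N. \<forall>m\<ge>N. bounded_by q (\<sigma> n - \<sigma> m) \<epsilon>" if "0 < \<epsilon>" for \<epsilon>
    proof -
      obtain N where N: "\<And>n m. N \<le> n \<Longrightarrow> N \<le> m \<Longrightarrow> ip_dist H (dual_ip q) (\<sigma> n) (\<sigma> m) < \<epsilon>"
        using \<sigma> \<open>0 < \<epsilon>\<close> unfolding M.MCauchy_def by meson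
      have "bounded_by q (\<sigma> n - \<sigma> m) \<epsilon>" if "N \<le> n" "N \<le> m" for n m
        using N[OF that] bounded_by_dual_norm[OF dual.closed(3)[OF mem[of n] mem[of m]]]
          mult_right_mono[OF less_imp_le[OF N[OF that]] form_norm_nonneg[OF UNIV_I]] \<open>0 < \<epsilon>\<close>
        unfolding bounded_by_def dual.ip_dist_eq[OF mem mem]
        by (meson less_imp_le order_trans)
      then show ?thesis by blast
    qed
    have "convergent (\<lambda>n. \<sigma> n b)" for b
    proof (rule Cauchy_convergent, rule metric_CauchyI)
      fix \<epsilon> :: real assume "0 < \<epsilon>"
      \<comment> \<open>Adding 1 keeps the divisor positive when \<open>b\<close> is a null
        vector.\<close>
      have pos: "0 < form_norm q b + 1" using form_norm_nonneg[of b] by simp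
      obtain N where N: "\<forall>n\<ge>N. \<forall>m\<ge>N. bounded_by q (\<sigma> n - \<sigma> m) (\<epsilon> / (form_norm q b + 1))"
        using ev[of "\<epsilon> / (form_norm q b + 1)"] pos \<open>0 < \<epsilon>\<close> by auto
      have "\<epsilon> / (form_norm q b + 1) * form_norm q b < \<epsilon>"
        using pos \<open>0 < \<epsilon>\<close> by (simp add: field_simps)
      then have "\<forall>n\<ge>N. \<forall>m\<ge>N. dist (\<sigma> n b) (\<sigma> m b) < \<epsilon>"
        using N unfolding bounded_by_def dist_norm by (metis le_less_trans minus_apply)
      then show "\<exists>N. \<forall>n\<ge>N. \<forall>m\<ge>N. dist (\<sigma> n b) (\<sigma> m b) < \<epsilon>" by blast
    qed
    then obtain \<phi> where \<phi>: "\<And>b. (\<lambda>n. \<sigma> n b) \<longlonglongrightarrow> \<phi> b"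
      unfolding convergent_def by metis
    \<comment> \<open>Let \<open>m\<close> tend to infinity in the Cauchy estimate at each fixed
      \<open>b\<close>.\<close>
    have ev': "\<exists>N. \<forall>n\<ge>N. bounded_by q (\<sigma> n - \<phi>) \<epsilon>" if pos: "0 < \<epsilon>" for \<epsilon>
    proof -
      obtain N where N: "\<forall>n\<ge>N. \<forall>m\<ge>N. bounded_by q (\<sigma> n - \<sigma> m) \<epsilon>" using ev pos by blast
      have "cmod (\<sigma> n b - \<phi> b) \<le> \<epsilon> * form_norm q b" if "N \<le> n" for n b
      proof (rule LIMSEQ_le_const2)
        show "(\<lambda>m. cmod (\<sigma> n b - \<sigma> m b)) \<longlonglongrightarrow> cmod (\<sigma> n b - \<phi> b)"
          by (intro tendsto_intros \<phi>)
        show "\<exists>N. \<forall>m\<ge>N. cmod (\<sigma> n b - \<sigma> m b) \<le> \<epsilon> * form_norm q b"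
          using N that by (auto simp: bounded_by_def)
      qed
      then show ?thesis using \<open>0 < \<epsilon>\<close> by (auto simp: bounded_by_def)
    qed
    have \<phi>_mem: "\<phi> \<in> H"
    proof -
      obtain n where n: "bounded_by q (\<sigma> n - \<phi>) 1" using ev'[of 1] by auto
      obtain C where "bounded_by q (\<sigma> n) C" using mem dual_bounded by blast
      from bounded_by_diff[OF this n] have bdd: "bounded_by q \<phi> (C + 1)" by simp
      show ?thesis
      proof (rule dual_memI[OF _ _ bdd])
        show "\<phi> (x + y) = \<phi> x + \<phi> y" for x y
          using tendsto_add[OF \<phi>[of x] \<phi>[of y]] \<phi>[of "x + y"] LIMSEQ_unique
          by (force simp: dual_add[OF mem])
        show "\<phi> (s c x) = cnj c * \<phi> x" for c x
          using tendsto_mult_left[OF \<phi>[of x], of "cnj c"] \<phi>[of "s c x"] LIMSEQ_unique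
          by (force simp: dual_scale[OF mem])
      qed
    qed
    have "limitin M.mtopology \<sigma> \<phi> sequentially"
      unfolding M.limit_metric_sequentially
    proof (intro conjI allI impI)
      fix \<epsilon> :: real assume "0 < \<epsilon>"
      then obtain N where N: "\<forall>n\<ge>N. bounded_by q (\<sigma> n - \<phi>) (\<epsilon> / 2)"
        using ev'[of "\<epsilon> / 2"] by auto
      have "ip_dist H (dual_ip q) (\<sigma> n) \<phi> < \<epsilon>" if "N \<le> n" for n
        using dual_norm_le[OF dual.closed(3)[OF mem \<phi>_mem], of n "\<epsilon> / 2"] N that \<open>0 < \<epsilon>\<close>
        by (simp add: dual.ip_dist_eq[OF mem \<phi>_mem])
      then show "\<exists>N. \<forall>n\<ge>N. \<sigma> n \<in> H \<and> ip_dist H (dual_ip q) (\<sigma> n) \<phi> < \<epsilon>"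
        using mem by blast
    qed (rule \<phi>_mem)
    then show "\<exists>\<phi>. limitin M.mtopology \<sigma> \<phi> sequentially" by blast
  qed
qed (use dual.hermitian_form_on subspace_dual vector_space_fun_scale in
    \<open>simp_all add: dual.nonneg dual_ip_definite\<close>)

end

section \<open>Self-dual majorants of a hermitian form\<close>

locale majorant = semi_inner_product s q + B: hermitian_form s UNIV B
  for s :: "complex \<Rightarrow> 'a::ab_group_add \<Rightarrow> 'a" and q B +
  assumes majorant: "cmod (B a a) \<le> Re (q a a)"
begin

text \<open>Cauchy-Schwarz for the two positive forms \<open>q + B\<close> and \<open>q - B\<close>.\<close>

lemma majorant_bound: "cmod (B a b) \<le> form_norm q a * form_norm q b"
proof -
  let ?P = "\<lambda>a b. q a b + B a b" and ?M = "\<lambda>a b. q a b - B a b"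
  have B_real: "Im (B a a) = 0" for a
    using arg_cong[OF B.form_sym[of a a], of Im] by simp
  have q_real: "Im (q a a) = 0" for a
    using arg_cong[OF form_sym[of a a], of Im] by simp
  have B_abs: "0 \<le> Re (q a a) + Re (B a a)" "Re (B a a) \<le> Re (q a a)" for a
    using order_trans[OF abs_Re_le_cmod majorant, of a] by linarith+
  have herm: "hermitian_form_on s UNIV ?P" "hermitian_form_on s UNIV ?M"
    unfolding hermitian_form_on_def complex_cnj_add complex_cnj_diff
    by (simp_all add: add_left B.add_left scale_left B.scale_left algebra_simps
        flip: form_sym B.form_sym)
  interpret P: positive_form s UNIV ?P
    using herm B_abs B_real q_real
    by unfold_locales (auto simp: less_eq_complex_def)
  interpret M: positive_form s UNIV ?M
    using herm B_abs B_real q_real by unfold_locales (auto simp: less_eq_complex_def)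
  define p m where "p = form_norm ?P" and "m = form_norm ?M"
  have pos: "0 \<le> p c" "0 \<le> m c" for c
    by (simp_all add: p_def m_def P.form_norm_nonneg M.form_norm_nonneg)
  \<comment> \<open>The contributions of \<open>B\<close> to the two squared norms cancel.\<close>
  have sq: "(p c)\<^sup>2 + (m c)\<^sup>2 = 2 * (form_norm q c)\<^sup>2" for c
    by (simp add: p_def m_def P.form_norm_sq M.form_norm_sq form_norm_sq)
  have "2 * cmod (B a b) = cmod (?P a b - ?M a b)" by (simp flip: mult_2 add: norm_mult)
  also have "\<dots> \<le> cmod (?P a b) + cmod (?M a b)" by (rule norm_triangle_ineq4)
  also have "\<dots> \<le> p a * p b + m a * m b"
    unfolding p_def m_def by (intro add_mono P.cauchy_schwarz M.cauchy_schwarz) auto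
  \<comment> \<open>Cauchy-Schwarz in the plane for the vectors \<open>(p a, m a)\<close> and
    \<open>(p b, m b)\<close>, whose squared lengths are given by \<open>sq\<close>; the discarded
    term is the square of \<open>p a * m b - m a * p b\<close>.\<close>
  also have "\<dots> \<le> 2 * (form_norm q a * form_norm q b)"
  proof (rule power2_le_imp_le)
    have "(p a * p b + m a * m b)\<^sup>2 \<le> ((p a)\<^sup>2 + (m a)\<^sup>2) * ((p b)\<^sup>2 + (m b)\<^sup>2)"
      using zero_le_power2[of "p a * m b - m a * p b"] by (simp add: power2_eq_square algebra_simps)
    then show "(p a * p b + m a * m b)\<^sup>2 \<le> (2 * (form_norm q a * form_norm q b))\<^sup>2"
      by (simp add: sq power_mult_distrib)
  qed (simp add: form_norm_nonneg)
  finally show ?thesis by simp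
qed

lemma bounded_by_majorant: "bounded_by q (B a) (form_norm q a)"
  by (simp add: bounded_by_def form_norm_nonneg majorant_bound)

lemma B_mem_dual: "B a \<in> H"
  by (rule dual_memI[OF _ _ bounded_by_majorant]) (simp_all add: B.add_right B.scale_right)

lemma B_add: "B (a + b) = B a + B b" and B_scale: "B (s c a) = fun_scale c (B a)"
  by (simp_all add: fun_eq_iff B.add_left B.scale_left)

lemma dual_norm_B_le: "form_norm (dual_ip q) (B a) \<le> form_norm q a"
  by (rule dual_norm_le[OF B_mem_dual bounded_by_majorant])

abbreviation dual_form :: "'a \<Rightarrow> 'a \<Rightarrow> complex" where
  "dual_form a b \<equiv> dual_ip q (B a) (B b)"

sublocale dual_form: positive_form s UNIV dual_form
proof unfold_locales
  show "hermitian_form_on s UNIV dual_form"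
    unfolding hermitian_form_on_def
    by (intro conjI ballI allI dual.form_sym)
      (simp_all only: B_add B_scale dual.add_left dual.scale_left B_mem_dual)
qed (rule subspace_UNIV dual.nonneg[OF B_mem_dual])+

text \<open>The map \<open>a \<mapsto> B a\<close> contracts into the antidual. Hence the mean with
  the dual form never exceeds \<open>q\<close>, and the iteration decreases.\<close>

lemma Re_dual_form_le: "Re (dual_form a a) \<le> Re (q a a)"
  using power_mono[OF dual_norm_B_le dual.form_norm_nonneg[OF B_mem_dual], of a 2]
  by (simp add: form_norm_sq dual.form_norm_sq B_mem_dual)

text \<open>\<open>|B a a|\<close> is at most the geometric, hence the arithmetic mean of the two squared norms.\<close>

lemma majorant_mean: "majorant s (\<lambda>a b. (q a b + dual_form a b) / 2) B"
proof (unfold_locales)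
  show "hermitian_form_on s UNIV (\<lambda>a b. (q a b + dual_form a b) / 2)"
    unfolding hermitian_form_on_def complex_cnj_add complex_cnj_divide
    by (simp add: add_left dual_form.add_left scale_left dual_form.scale_left add_divide_distrib
        algebra_simps flip: form_sym dual_form.form_sym)
  show "0 \<le> (q a a + dual_form a a) / 2" for a
    using nonneg[of a] dual_form.nonneg[of a] by (simp add: less_eq_complex_def)
  show "cmod (B a a) \<le> Re ((q a a + dual_form a a) / 2)" for a
  proof -
    let ?N = "form_norm q a" and ?D = "form_norm dual_form a"
    have "cmod (B a a) \<le> ?D * ?N"
      using bounded_by_dual_norm[OF B_mem_dual, of a] by (simp add: bounded_by_def form_norm_def)
    also have "\<dots> \<le> (?N\<^sup>2 + ?D\<^sup>2) / 2"
      using zero_le_power2[of "?N - ?D"] by (simp add: power2_diff algebra_simps)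
    finally show ?thesis by (simp add: form_norm_sq dual_form.form_norm_sq)
  qed
qed (rule subspace_UNIV)

end

section \<open>The iteration of means and its limit\<close>

primrec majorant_seq ::
  "('a \<Rightarrow> 'a \<Rightarrow> complex) \<Rightarrow> ('a \<Rightarrow> 'a \<Rightarrow> complex) \<Rightarrow> nat \<Rightarrow> 'a \<Rightarrow> 'a \<Rightarrow> complex" where
  "majorant_seq q B 0 = q"
| "majorant_seq q B (Suc n) =
    (\<lambda>a b. (majorant_seq q B n a b + dual_ip (majorant_seq q B n) (B a) (B b)) / 2)"

context majorant
begin

lemma majorant_majorant_seq: "majorant s (majorant_seq q B n) B"
proof (induction n)
  case (Suc n)
  then show ?case by (simp add: majorant.majorant_mean)
qed (simp add: majorant_axioms)

lemma Re_majorant_seq_Suc: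
  "Re (majorant_seq q B (Suc n) a a) =
    (Re (majorant_seq q B n a a) + Re (dual_ip (majorant_seq q B n) (B a) (B a))) / 2"
  by simp

lemma majorant_seq_decseq: "decseq (\<lambda>n. Re (majorant_seq q B n a a))"
proof (rule decseq_SucI)
  fix n
  interpret n: majorant s "majorant_seq q B n" B by (rule majorant_majorant_seq)
  show "Re (majorant_seq q B (Suc n) a a) \<le> Re (majorant_seq q B n a a)"
    using n.Re_dual_form_le[of a] by simp
qed

definition majorant_lim :: "'a \<Rightarrow> 'a \<Rightarrow> complex" where
  "majorant_lim a b = lim (\<lambda>n. majorant_seq q B n a b)"

text \<open>Diagonal values converge, being decreasing and nonnegative; polarization carries the
  convergence to all pairs.\<close>

lemma majorant_seq_tendsto: "(\<lambda>n. majorant_seq q B n a b) \<longlonglongrightarrow> majorant_lim a b"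
proof -
  let ?Q = "\<lambda>n a. Re (majorant_seq q B n a a)"
  have "\<exists>l. (\<lambda>n. ?Q n a) \<longlonglongrightarrow> l" for a
  proof -
    have "0 \<le> ?Q n a" for n
    proof -
      interpret n: majorant s "majorant_seq q B n" B by (rule majorant_majorant_seq)
      show ?thesis by (simp add: n.Re_form_nonneg)
    qed
    then show ?thesis using decseq_convergent[OF majorant_seq_decseq] by metis
  qed
  then obtain l where l: "\<And>a. (\<lambda>n. ?Q n a) \<longlonglongrightarrow> l a" by metis
  have "hermitian_form s UNIV (majorant_seq q B n)" for n
  proof -
    interpret n: majorant s "majorant_seq q B n" B by (rule majorant_majorant_seq)
    show ?thesis ..
  qed
  from hermitian_form.polarization[OF this, of a b]
  have eq: "(\<lambda>n. majorant_seq q B n a b) = (\<lambda>n. Complex ((?Q n (a + b) - ?Q n a - ?Q n b) / 2)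
      (- (?Q n (s \<i> a + b) - ?Q n (s \<i> a) - ?Q n b) / 2))"
    by simp
  have "convergent (\<lambda>n. majorant_seq q B n a b)"
    unfolding eq convergent_def by (rule exI, (rule tendsto_intros l zero_neq_numeral[symmetric])+)
  then show ?thesis by (simp add: majorant_lim_def convergent_LIMSEQ_iff)
qed

lemma majorant_majorant_lim: "majorant s majorant_lim B"
proof unfold_locales
  have n: "majorant s (majorant_seq q B n) B" for n by (rule majorant_majorant_seq)
  have herm: "hermitian_form s UNIV (majorant_seq q B n)" for n
    using n[of n] by (simp add: majorant_def semi_inner_product_def positive_form_def)
  note limI = LIMSEQ_unique[OF majorant_seq_tendsto]
  have "majorant_lim (x + y) z = majorant_lim x z + majorant_lim y z" for x y z
    by (rule limI)
      (simp add: hermitian_form.add_left[OF herm] tendsto_add majorant_seq_tendsto)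
  moreover have "majorant_lim (s c x) y = c * majorant_lim x y" for c x y
    by (rule limI)
      (simp add: hermitian_form.scale_left[OF herm] tendsto_mult_left majorant_seq_tendsto)
  moreover have "majorant_lim x y = cnj (majorant_lim y x)" for x y
    by (rule limI)
      (subst hermitian_form.form_sym[OF herm], simp_all add: tendsto_cnj majorant_seq_tendsto)
  ultimately show "hermitian_form_on s UNIV majorant_lim"
    unfolding hermitian_form_on_def by blast
  show bound: "cmod (B a a) \<le> Re (majorant_lim a a)" for a
    by (rule LIMSEQ_le_const[OF tendsto_Re[OF majorant_seq_tendsto]])
      (use majorant.majorant[OF n] in blast)
  \<comment> \<open>The real part lies above \<open>cmod (B a a)\<close>, and hermitian symmetry
    makes the diagonal real.\<close>
  show "0 \<le> majorant_lim a a" for a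
    using bound[of a] norm_ge_zero[of "B a a"] arg_cong[OF \<open>majorant_lim a a = _\<close>, of Im]
      \<open>majorant_lim a a = cnj (majorant_lim a a)\<close>
    by (auto simp: less_eq_complex_def complex_eq_iff simp del: norm_ge_zero)
qed (rule subspace_UNIV)

text \<open>Replacing a majorant by the mean of itself and its dual form decreases it; the limit of the
  iteration coincides with its dual form. This takes the place of the polar decomposition of the
  Gram operator of \<open>B\<close>.\<close>

lemma self_dual_majorant_lim: "Re (dual_ip majorant_lim (B a) (B a)) = Re (majorant_lim a a)"
proof (rule antisym)
  interpret L: majorant s majorant_lim B by (rule majorant_majorant_lim)
  show "Re (L.dual_form a a) \<le> Re (majorant_lim a a)" by (rule L.Re_dual_form_le)
  \<comment> \<open>Duality reverses the order: \<open>majorant_lim\<close> lies below every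
    iterate, so a bound relative to it is also a bound relative to the iterate.\<close>
  have le: "Re (dual_ip (majorant_seq q B n) (B a) (B a)) \<le> Re (L.dual_form a a)" for n
  proof -
    interpret n: majorant s "majorant_seq q B n" B by (rule majorant_majorant_seq)
    have "Re (majorant_lim b b) \<le> Re (majorant_seq q B n b b)" for b
      by (rule decseq_ge[OF majorant_seq_decseq tendsto_Re[OF majorant_seq_tendsto]])
    then have mono: "form_norm majorant_lim b \<le> form_norm (majorant_seq q B n) b" for b
      by (simp add: form_norm_def)
    let ?C = "form_norm (dual_ip majorant_lim) (B a)"
    have C: "bounded_by majorant_lim (B a) ?C"
      by (rule L.bounded_by_dual_norm[OF L.B_mem_dual])
    then have "bounded_by (majorant_seq q B n) (B a) ?C"
      using mono unfolding bounded_by_def by (meson mult_left_mono order_trans)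
    from n.dual_norm_le[OF n.B_mem_dual this] show ?thesis
      by (simp add: form_norm_def)
  qed
  \<comment> \<open>This is the recurrence solved for the dual form of the current iterate.\<close>
  have "(\<lambda>n. 2 * Re (majorant_seq q B (Suc n) a a) - Re (majorant_seq q B n a a))
      \<longlonglongrightarrow> 2 * Re (majorant_lim a a) - Re (majorant_lim a a)"
    by (intro tendsto_intros tendsto_Re LIMSEQ_Suc[OF tendsto_Re[OF majorant_seq_tendsto]] majorant_seq_tendsto)
  then have "(\<lambda>n. Re (dual_ip (majorant_seq q B n) (B a) (B a))) \<longlonglongrightarrow> Re (majorant_lim a a)"
    unfolding Re_majorant_seq_Suc by (simp add: add_divide_distrib)
  then show "Re (majorant_lim a a) \<le> Re (L.dual_form a a)"
    by (rule LIMSEQ_le_const2) (use le in blast)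
qed

end

section \<open>The symmetry and the Krein form of a self-dual majorant\<close>

locale self_dual_majorant = majorant +
  assumes self_dual: "Re (dual_ip q (B a) (B a)) = Re (q a a)"
begin

lemma dual_form_eq: "dual_ip q (B a) (B b) = q a b"
  by (rule hermitian_form_eqI[of s UNIV])
    (auto simp: self_dual dual_form.hermitian_form_axioms hermitian_form_axioms)

text \<open>The Gram operator should send \<open>q b\<close> to \<open>B b\<close>. Requiring it to
  be symmetric as well forces this value at \<open>b\<close>, by the reproducing property, and so
  defines it on the whole dual without extension by continuity.\<close>

definition J :: "('a \<Rightarrow> complex) \<Rightarrow> 'a \<Rightarrow> complex" where
  "J \<phi> = (\<lambda>b. dual_ip q \<phi> (B b))"

lemma J_B: "J (B a) = q a"
  by (simp add: J_def dual_form_eq)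

lemma J_form: "J (q a) = B a"
  by (simp add: J_def fun_eq_iff dual_ip_form B_mem_dual flip: B.form_sym)

lemma J_bounded: "\<phi> \<in> H \<Longrightarrow> bounded_by q (J \<phi>) (form_norm (dual_ip q) \<phi>)"
  unfolding bounded_by_def J_def
  using dual.cauchy_schwarz[OF _ B_mem_dual] dual_norm_B_le
  by (meson dual.form_norm_nonneg mult_left_mono order_trans)

lemma J_mem: "\<phi> \<in> H \<Longrightarrow> J \<phi> \<in> H"
  by (rule dual_memI[OF _ _ J_bounded])
    (simp_all add: J_def B_add B_scale dual.add_right dual.scale_right B_mem_dual)

lemma J_norm_le: "\<phi> \<in> H \<Longrightarrow> form_norm (dual_ip q) (J \<phi>) \<le> form_norm (dual_ip q) \<phi>"
  by (rule dual_norm_le[OF J_mem J_bounded])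

lemma J_add: "\<phi> \<in> H \<Longrightarrow> \<psi> \<in> H \<Longrightarrow> J (\<phi> + \<psi>) = J \<phi> + J \<psi>"
  and J_diff: "\<phi> \<in> H \<Longrightarrow> \<psi> \<in> H \<Longrightarrow> J (\<phi> - \<psi>) = J \<phi> - J \<psi>"
  and J_scale: "\<phi> \<in> H \<Longrightarrow> J (fun_scale c \<phi>) = fun_scale c (J \<phi>)"
  by (simp_all add: J_def fun_eq_iff dual.add_left dual.diff_left dual.scale_left B_mem_dual)

text \<open>For \<open>\<psi> = q a\<close> both sides equal \<open>dual_ip q \<phi> (B a)\<close>.
  Such \<open>\<psi>\<close> are dense and \<open>J\<close> is a contraction, so the defect is below
  every positive multiple of the norm of \<open>\<phi>\<close>.\<close>

lemma J_symmetric: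
  assumes "\<phi> \<in> H" "\<psi> \<in> H" shows "dual_ip q (J \<phi>) \<psi> = dual_ip q \<phi> (J \<psi>)"
proof -
  let ?N = "form_norm (dual_ip q)"
  have bound: "cmod (dual_ip q (J \<phi>) \<psi> - dual_ip q \<phi> (J \<psi>)) \<le> 2 * ?N \<phi> * \<epsilon>" if "0 < \<epsilon>" for \<epsilon>
  proof -
    obtain a where a: "?N (\<psi> - q a) \<le> \<epsilon>" by (rule dual_norm_dense[OF assms(2) \<open>0 < \<epsilon>\<close>])
    let ?d = "\<psi> - q a"
    have d: "?d \<in> H" using assms form_mem_dual by (intro dual.closed)
    have eq: "dual_ip q (J \<phi>) (q a) = dual_ip q \<phi> (J (q a))"
      unfolding dual_ip_form_right[OF J_mem[OF assms(1)]] J_form by (simp add: J_def)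
    have "cmod (dual_ip q (J \<phi>) \<psi> - dual_ip q \<phi> (J \<psi>)) =
        cmod (dual_ip q (J \<phi>) ?d - dual_ip q \<phi> (J ?d))"
      using assms form_mem_dual by (simp add: J_diff dual.diff_right J_mem eq)
    also have "\<dots> \<le> cmod (dual_ip q (J \<phi>) ?d) + cmod (dual_ip q \<phi> (J ?d))"
      by (rule norm_triangle_ineq4)
    also have "\<dots> \<le> ?N (J \<phi>) * ?N ?d + ?N \<phi> * ?N (J ?d)"
      by (intro add_mono dual.cauchy_schwarz[OF J_mem[OF assms(1)] d]
          dual.cauchy_schwarz[OF assms(1) J_mem[OF d]])
    also have "\<dots> \<le> ?N \<phi> * \<epsilon> + ?N \<phi> * \<epsilon>"
      by (intro add_mono mult_mono J_norm_le[OF assms(1)] a order_trans[OF J_norm_le[OF d] a]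
          order_refl dual.form_norm_nonneg assms(1) d J_mem[OF d])
    finally show ?thesis by (simp add: mult_ac)
  qed
  have "((\<lambda>\<epsilon>. 2 * ?N \<phi> * \<epsilon>) \<longlongrightarrow> 2 * ?N \<phi> * 0) (at_right 0)" by (intro tendsto_intros)
  then have "cmod (dual_ip q (J \<phi>) \<psi> - dual_ip q \<phi> (J \<psi>)) \<le> 2 * ?N \<phi> * 0"
    by (rule tendsto_lowerbound)
      (rule eventually_mono[OF eventually_at_right_less bound], simp_all)
  then show ?thesis by simp
qed

text \<open>Self-duality enters here: through \<open>dual_form_eq\<close>, \<open>J\<close> sends
  \<open>B b\<close> back to \<open>q b\<close>. Symmetry moves one \<open>J\<close> onto
  \<open>B b\<close>, and pairing with \<open>q b\<close> reproduces the value at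
  \<open>b\<close>.\<close>

lemma J_J:
  assumes "\<phi> \<in> H" shows "J (J \<phi>) = \<phi>"
proof
  fix b
  have "J (J \<phi>) b = dual_ip q \<phi> (q b)"
    using J_symmetric[OF assms B_mem_dual, of b] unfolding J_B by (simp add: J_def)
  also have "\<dots> = \<phi> b"
    by (rule dual_ip_form_right[OF assms])
  finally show "J (J \<phi>) b = \<phi> b" .
qed

definition krein_form :: "('a \<Rightarrow> complex) \<Rightarrow> ('a \<Rightarrow> complex) \<Rightarrow> complex" where
  "krein_form \<phi> \<psi> = dual_ip q (J \<phi>) \<psi>"

text \<open>The dual is thus a reproducing kernel Krein space with kernel functions
  \<open>B b\<close>; later identities about the representation reduce to evaluations.\<close>

lemma krein_form_B:
  assumes "\<phi> \<in> H" shows "krein_form \<phi> (B b) = \<phi> b"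
  using fun_cong[OF J_J[OF assms], of b] by (simp add: krein_form_def J_def)

lemma krein_structure: "krein_structure fun_scale H krein_form (dual_ip q) J"
proof -
  have "krein_form (\<phi> + \<psi>) \<eta> = krein_form \<phi> \<eta> + krein_form \<psi> \<eta>"
    if "\<phi> \<in> H" "\<psi> \<in> H" "\<eta> \<in> H" for \<phi> \<psi> \<eta>
    using that by (simp add: krein_form_def J_add dual.add_left J_mem)
  moreover have "krein_form (fun_scale c \<phi>) \<psi> = c * krein_form \<phi> \<psi>"
    if "\<phi> \<in> H" "\<psi> \<in> H" for c \<phi> \<psi>
    using that by (simp add: krein_form_def J_scale dual.scale_left J_mem)
  moreover have "krein_form \<phi> \<psi> = cnj (krein_form \<psi> \<phi>)" if "\<phi> \<in> H" "\<psi> \<in> H" for \<phi> \<psi>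
    unfolding krein_form_def J_symmetric[OF that] by (intro dual.form_sym J_mem that)
  ultimately have "hermitian_form_on fun_scale H krein_form"
    unfolding hermitian_form_on_def by blast
  then show ?thesis
    by (simp add: krein_structure_def hilbert_space_dual linear_into_def J_mem J_add J_scale
        J_symmetric J_J krein_form_def)
qed

sublocale krein: hermitian_form fun_scale H krein_form
proof unfold_locales
  show "hermitian_form_on fun_scale H krein_form"
    using krein_structure unfolding krein_structure_def by blast
qed (rule dual.subspace_K)

text \<open>The contractive involution \<open>J\<close> maps the dense family \<open>q a\<close>
  onto the family \<open>B a\<close>.\<close>

lemma range_B_dense:
  assumes "\<phi> \<in> H" "0 < \<epsilon>"
  obtains a where "form_norm (dual_ip q) (\<phi> - B a) \<le> \<epsilon>"
proof -
  obtain a where a: "form_norm (dual_ip q) (J \<phi> - q a) \<le> \<epsilon>"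
    by (rule dual_norm_dense[OF J_mem[OF assms(1)] assms(2)])
  have "\<phi> - B a = J (J \<phi> - q a)"
    using assms by (simp add: J_diff J_mem form_mem_dual J_J J_form)
  then have "form_norm (dual_ip q) (\<phi> - B a) \<le> \<epsilon>"
    using J_norm_le[of "J \<phi> - q a"] a assms dual.closed(3)[OF J_mem form_mem_dual]
    by (metis order_trans)
  then show thesis ..
qed

end

section \<open>From GNS data to a dominating kernel\<close>

text \<open>Makes the definite description in \<open>krein_adjoint\<close> meaningful. The symmetry
  turns equal pairings under \<open>f\<close> into orthogonality of \<open>J z - J z'\<close> to the
  dense set \<open>D\<close>, so this difference vanishes, and \<open>J\<close> is
  injective.\<close>

lemma krein_adjoint_unique:
  assumes kr: "krein_structure s K f ip J" and dense: "ip_topology K ip closure_of D = K"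
    and "D \<subseteq> K" "z \<in> K" "z' \<in> K" and eq: "\<And>x. x \<in> D \<Longrightarrow> f x z = f x z'"
  shows "z = z'"
proof -
  have hilb: "hilbert_space_on s K ip" and J: "linear_into s K K J"
      "\<And>x y. x \<in> K \<Longrightarrow> y \<in> K \<Longrightarrow> ip (J x) y = ip x (J y)" "\<And>x. x \<in> K \<Longrightarrow> J (J x) = x"
      "\<And>x y. x \<in> K \<Longrightarrow> y \<in> K \<Longrightarrow> f x y = ip (J x) y"
    using kr unfolding krein_structure_def by blast+
  from hilb interpret vector_space s by (simp add: hilbert_space_on_def)
  interpret ip: positive_form s K ip
    using hilb unfolding hilbert_space_on_def by unfold_locales blast+
  have definite: "\<And>x. x \<in> K \<Longrightarrow> ip x x = 0 \<Longrightarrow> x = 0"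
    using hilb unfolding hilbert_space_on_def by blast
  interpret M: Metric_space K "ip_dist K ip" by (rule ip.Metric_space_ip_dist[OF definite])
  have JK: "J x \<in> K" if "x \<in> K" for x using J(1) that by (simp add: linear_into_def)
  define w where "w = J z - J z'"
  have w: "w \<in> K" unfolding w_def by (intro ip.closed JK assms)
  have orth: "ip x w = 0" if "x \<in> D" for x
    using eq[OF that] that assms JK J(2,4) by (simp add: w_def ip.diff_right subset_iff)
  have bound: "(form_norm ip w)\<^sup>2 \<le> \<epsilon> * form_norm ip w" if "0 < \<epsilon>" for \<epsilon>
  proof -
    have "w \<in> ip_topology K ip closure_of D" using dense w by simp
    then obtain x where x: "x \<in> D" "x \<in> M.mball w \<epsilon>"
      using \<open>0 < \<epsilon>\<close> unfolding M.metric_closure_of by blast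
    then have xK: "x \<in> K" and d: "form_norm ip (w - x) < \<epsilon>"
      by (auto simp: ip.ip_dist_eq)
    have "(form_norm ip w)\<^sup>2 = Re (ip (w - x) w)"
      using w xK orth[OF x(1)] by (simp add: ip.form_norm_sq ip.diff_left)
    also have "\<dots> \<le> form_norm ip (w - x) * form_norm ip w"
      using ip.cauchy_schwarz[OF ip.closed(3)[OF w xK] w] complex_Re_le_cmod order_trans by blast
    also have "\<dots> \<le> \<epsilon> * form_norm ip w"
      using d by (intro mult_right_mono less_imp_le ip.form_norm_nonneg w)
    finally show ?thesis .
  qed
  have "form_norm ip w = 0"
  proof (rule ccontr)
    assume "form_norm ip w \<noteq> 0"
    then have "0 < form_norm ip w" using ip.form_norm_nonneg[OF w] by simp
    then show False using bound[of "form_norm ip w / 2"] by (simp add: power2_eq_square)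
  qed
  then have "w = 0" using definite[OF w] ip.form_same[OF w] by simp
  then have "J (J z) = J (J z')" by (simp add: w_def)
  then show ?thesis using J(3) assms by simp
qed

lemma gns_data_imp_kernel:
  assumes A: "complex_star_algebra scaleA star" and lin: "Vector_Spaces.linear scaleA (*) Z"
    and gns: "gns_data scaleA star Z s K f D \<pi> \<Omega>"
  shows "\<exists>L. positive_definite_kernel L \<and> dominated_by_kernel scaleA star Z L"
proof -
  interpret A: complex_star_algebra scaleA star by (rule A)
  interpret Z: Vector_Spaces.linear scaleA "(*)" Z by (rule lin)
  obtain ip J where kr: "krein_structure s K f ip J"
    and rep: "closable_representation scaleA s K ip D \<pi>"
    using gns unfolding gns_data_def by blast
  have herm: "hermitian_representation star K f D \<pi>" and \<Omega>: "\<Omega> \<in> D"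
    and Z: "\<And>a. Z a = f (\<pi> a \<Omega>) \<Omega>"
    using gns unfolding gns_data_def by blast+
  have DK: "D \<subseteq> K" and dense: "ip_topology K ip closure_of D = K"
    and \<pi>: "\<And>a x. x \<in> D \<Longrightarrow> \<pi> a x \<in> D" "\<And>a b x. x \<in> D \<Longrightarrow> \<pi> (a * b) x = \<pi> a (\<pi> b x)"
    using rep unfolding closable_representation_def linear_into_def by blast+
  have hilb: "hilbert_space_on s K ip" and f: "hermitian_form_on s K f"
    and J: "\<And>x. x \<in> K \<Longrightarrow> J x \<in> K" "\<And>x. x \<in> K \<Longrightarrow> J (J x) = x"
      "\<And>x y. x \<in> K \<Longrightarrow> y \<in> K \<Longrightarrow> ip (J x) y = ip x (J y)"
      "\<And>x y. x \<in> K \<Longrightarrow> y \<in> K \<Longrightarrow> f x y = ip (J x) y"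
    using kr unfolding krein_structure_def linear_into_def by blast+
  from hilb interpret vector_space s by (simp add: hilbert_space_on_def)
  interpret ip: positive_form s K ip
    using hilb unfolding hilbert_space_on_def by unfold_locales blast+
  interpret f: hermitian_form s K f
    by unfold_locales (use f ip.subspace_K in blast)+
  have adj: "f (\<pi> a x) y = f x (\<pi> (star a) y)" if "x \<in> D" "y \<in> D" for a x y
  proof -
    have "y \<in> krein_adjoint_domain K f D (\<pi> a)" and y: "krein_adjoint K f D (\<pi> a) y = \<pi> (star a) y"
      using herm \<open>y \<in> D\<close> unfolding hermitian_representation_def by blast+
    then obtain z where z: "z \<in> K \<and> (\<forall>x\<in>D. f (\<pi> a x) y = f x z)"
      unfolding krein_adjoint_domain_def by blast
    moreover have "w = z" if "w \<in> K \<and> (\<forall>x\<in>D. f (\<pi> a x) y = f x w)" for w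
      by (rule krein_adjoint_unique[OF kr dense DK]) (use that z in auto)
    ultimately have "krein_adjoint K f D (\<pi> a) y = z"
      unfolding krein_adjoint_def by (rule the_equality)
    then show ?thesis using z y \<open>x \<in> D\<close> by simp
  qed
  \<comment> \<open>The stars here and the swapped arguments in \<open>L\<close> come from
    \<open>Z_mult\<close>: moving \<open>\<pi> x\<close> across the form turns it into
    \<open>\<pi> (star x)\<close>.\<close>
  define e where "e x = \<pi> (star x) \<Omega>" for x
  define L where "L x y = ip (e y) (e x)" for x y
  have e: "e x \<in> K" for x using \<pi> \<Omega> DK by (auto simp: e_def)
  have Z_mult: "Z (x * star y) = f (e y) (e x)" for x y
    using adj[of "\<pi> (star y) \<Omega>" \<Omega> x] by (simp add: Z \<pi> \<Omega> e_def)
  have ip_vec: "(\<Sum>i<n. \<Sum>j<n. L (x i) (x j) * l j * cnj (l i)) =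
      ip (\<Sum>j<n. s (l j) (e (x j))) (\<Sum>j<n. s (l j) (e (x j)))"
    for n :: nat and l and x :: "nat \<Rightarrow> 'a"
  proof -
    have "(\<Sum>i<n. \<Sum>j<n. L (x i) (x j) * l j * cnj (l i)) =
        (\<Sum>j<n. \<Sum>i<n. l j * cnj (l i) * ip (e (x j)) (e (x i)))"
      by (subst sum.swap) (simp add: L_def mult_ac)
    then show ?thesis by (simp add: ip.form_sum_sum e)
  qed
  have vec_mem: "(\<Sum>j<n. s (l j) (e (x j))) \<in> K" for n :: nat and l and x :: "nat \<Rightarrow> 'a"
    by (intro subspace_sum[OF ip.subspace_K] ip.closed e)
  have "positive_definite_kernel L"
    unfolding positive_definite_kernel_def ip_vec
  proof (intro conjI allI)
    show "L x y = cnj (L y x)" for x y unfolding L_def by (intro ip.form_sym e)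
  qed (intro ip.nonneg vec_mem)
  moreover have "dominated_by_kernel scaleA star Z L"
    unfolding dominated_by_kernel_def
  proof (intro allI)
    fix n :: nat and l and x :: "nat \<Rightarrow> 'a"
    \<comment> \<open>Conjugated coefficients, because \<open>e (x j)\<close> stands in the first,
      linear slot of \<open>f\<close> and carries the factor \<open>cnj (l j)\<close>.\<close>
    define v where "v = (\<Sum>j<n. s (cnj (l j)) (e (x j)))"
    have v: "v \<in> K" unfolding v_def by (rule vec_mem)
    have "Z (\<Sum>i<n. \<Sum>j<n. scaleA (l i * cnj (l j)) (x i * star (x j))) =
        (\<Sum>i<n. \<Sum>j<n. l i * cnj (l j) * f (e (x j)) (e (x i)))"
      by (simp add: Z.sum Z.scale Z_mult)
    also have "\<dots> = (\<Sum>j<n. \<Sum>i<n. cnj (l j) * cnj (cnj (l i)) * f (e (x j)) (e (x i)))"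
      by (subst sum.swap) (simp add: mult_ac)
    also have "\<dots> = f v v" unfolding v_def by (rule f.form_sum_sum[symmetric]) (rule e)+
    finally have lhs: "Z (\<Sum>i<n. \<Sum>j<n. scaleA (l i * cnj (l j)) (x i * star (x j))) = f v v" .
    have rhs: "(\<Sum>i<n. \<Sum>j<n. l i * cnj (l j) * L (x i) (x j)) = ip v v"
      using ip_vec[where l = "\<lambda>i. cnj (l i)" and n = n and x = x] by (simp add: v_def mult_ac)
    have "ip (J v) (J v) = ip v v" using J v by simp
    then have "form_norm ip (J v) = form_norm ip v" by (simp add: form_norm_def)
    then have "cmod (f v v) \<le> (form_norm ip v)\<^sup>2"
      using ip.cauchy_schwarz[OF J(1)[OF v] v] J v by (simp add: power2_eq_square)
    then show "complex_of_real (cmod (Z (\<Sum>i<n. \<Sum>j<n. scaleA (l i * cnj (l j)) (x i * star (x j)))))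
        \<le> (\<Sum>i<n. \<Sum>j<n. l i * cnj (l j) * L (x i) (x j))"
      unfolding lhs rhs ip.form_same[OF v] by (simp add: less_eq_complex_def)
  qed
  ultimately show ?thesis by blast
qed

section \<open>From a dominating kernel to GNS data\<close>

text \<open>Domination speaks of families indexed by initial segments of the naturals, basis
  expansions of sums over finite sets of basis vectors; a bijection mediates.\<close>

lemma sum_sum_reindex:
  assumes "bij_betw h I J"
  shows "(\<Sum>i\<in>J. \<Sum>j\<in>J. g i j) = (\<Sum>i\<in>I. \<Sum>j\<in>I. g (h i) (h j))"
  using sum.reindex_bij_betw[OF assms, of "\<lambda>i. \<Sum>j\<in>J. g i j"]
    sum.reindex_bij_betw[OF assms, of "g _"] by simp

text \<open>The kernel is sampled on a Hamel basis and extended sesquilinearly; domination on arbitrary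
  finite families, applied to basis expansions, survives.\<close>

lemma kernel_imp_majorant:
  assumes A: "complex_star_algebra scaleA star" and lin: "Vector_Spaces.linear scaleA (*) Z"
    and herm: "hermitian_functional star Z"
    and pd: "positive_definite_kernel L" and dom: "dominated_by_kernel scaleA star Z L"
  shows "\<exists>q. majorant scaleA q (\<lambda>a b. Z (star b * a))"
proof -
  interpret A: complex_star_algebra scaleA star by (rule A)
  interpret Z: Vector_Spaces.linear scaleA "(*)" Z by (rule lin)
  define E where "E = A.extend_basis {}"
  have E: "A.independent E" "A.span E = UNIV"
    by (simp_all add: E_def A.independent_extend_basis A.independent_empty)
  define r where "r = A.representation E"
  define S where "S x = {e. r x e \<noteq> 0}" for x
  have fin: "finite (S x)" for x unfolding S_def r_def by (rule A.finite_representation)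
  have r_add: "r (x + y) e = r x e + r y e" and r_scale: "r (scaleA c x) e = c * r x e" for x y c e
    using E by (simp_all add: r_def A.representation_add A.representation_scale)
  have expand: "(\<Sum>e\<in>S x. scaleA (r x e) e) = x" for x
    using A.sum_nonzero_representation_eq[OF E(1), of x] E(2) by (simp add: S_def r_def)
  define q0 where "q0 x y = (\<Sum>i\<in>S x. \<Sum>j\<in>S y. r x i * cnj (r y j) * L i j)" for x y
  \<comment> \<open>Enlarging the supports adds only zero terms. This puts \<open>x\<close>,
    \<open>y\<close> and \<open>x + y\<close> over one index set.\<close>
  have q0: "q0 x y = (\<Sum>i\<in>F. \<Sum>j\<in>G. r x i * cnj (r y j) * L i j)"
    if F: "finite F" "S x \<subseteq> F" and G: "finite G" "S y \<subseteq> G" for x y F G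
  proof -
    have "q0 x y = (\<Sum>i\<in>S x. \<Sum>j\<in>G. r x i * cnj (r y j) * L i j)"
      unfolding q0_def
      by (intro sum.cong refl sum.mono_neutral_left) (use G in \<open>auto simp: S_def\<close>)
    also have "\<dots> = (\<Sum>i\<in>F. \<Sum>j\<in>G. r x i * cnj (r y j) * L i j)"
      by (intro sum.mono_neutral_left) (use F in \<open>auto simp: S_def\<close>)
    finally show ?thesis .
  qed
  have L_sym: "L x y = cnj (L y x)" for x y
    using pd unfolding positive_definite_kernel_def by blast
  have q0_add: "q0 (x + y) z = q0 x z + q0 y z" for x y z
  proof -
    let ?F = "S x \<union> S y"
    have "S (x + y) \<subseteq> ?F" by (auto simp: S_def r_add)
    then have "q0 w z = (\<Sum>i\<in>?F. \<Sum>j\<in>S z. r w i * cnj (r z j) * L i j)"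
      if "w \<in> {x, y, x + y}" for w
      using that fin by (intro q0) auto
    then show ?thesis by (simp add: r_add distrib_right sum.distrib)
  qed
  have q0_scale: "q0 (scaleA c x) y = c * q0 x y" for c x y
  proof -
    have "S (scaleA c x) \<subseteq> S x" by (auto simp: S_def r_scale)
    then have "q0 (scaleA c x) y = (\<Sum>i\<in>S x. \<Sum>j\<in>S y. r (scaleA c x) i * cnj (r y j) * L i j)"
      using fin by (intro q0) auto
    then show ?thesis by (simp add: q0_def r_scale sum_distrib_left mult.assoc)
  qed
  have q0_sym: "q0 x y = cnj (q0 y x)" for x y
  proof -
    have "cnj (q0 y x) = (\<Sum>i\<in>S y. \<Sum>j\<in>S x. r x j * cnj (r y i) * L j i)"
      unfolding q0_def by (simp add: L_sym[symmetric] mult_ac)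
    also have "\<dots> = q0 x y" unfolding q0_def by (rule sum.swap)
    finally show ?thesis ..
  qed
  have q0_dom: "complex_of_real (cmod (Z (x * star x))) \<le> q0 x x" for x
  proof -
    let ?n = "card (S x)"
    obtain h where h: "bij_betw h {..<?n} (S x)"
      using ex_bij_betw_nat_finite[OF fin] unfolding atLeast0LessThan by blast
    have star_sum: "star (\<Sum>e\<in>F. g e) = (\<Sum>e\<in>F. star (g e))" if "finite F" for F and g :: "'a \<Rightarrow> 'a"
      using that
    proof induction
      case empty
      show ?case using A.star_add[of 0 0] by simp
    qed (simp add: A.star_add)
    have "x * star x = (\<Sum>i\<in>S x. scaleA (r x i) i) * star (\<Sum>j\<in>S x. scaleA (r x j) j)"
      by (simp add: expand)
    also have "\<dots> = (\<Sum>i\<in>S x. \<Sum>j\<in>S x. scaleA (r x i * cnj (r x j)) (i * star j))"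
      by (simp add: star_sum fin sum_product A.star_scale A.mult_scale_left A.mult_scale_right)
        (simp add: mult.commute)
    also have "\<dots> = (\<Sum>i<?n. \<Sum>j<?n.
        scaleA (r x (h i) * cnj (r x (h j))) (h i * star (h j)))"
      by (rule sum_sum_reindex[OF h])
    finally have lhs: "x * star x = \<dots>" .
    have rhs: "q0 x x = (\<Sum>i<?n. \<Sum>j<?n. r x (h i) * cnj (r x (h j)) * L (h i) (h j))"
      unfolding q0_def by (rule sum_sum_reindex[OF h])
    show ?thesis
      unfolding lhs rhs by (rule dom[unfolded dominated_by_kernel_def, rule_format])
  qed
  \<comment> \<open>Domination controls \<open>Z (x * star x)\<close>, while the form to be
    majorized has the diagonal \<open>Z (star a * a)\<close>; hence the stars. As
    \<open>star\<close> is antilinear, the arguments are swapped to keep \<open>q\<close> linear in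
    the first one.\<close>
  define q where "q a b = q0 (star b) (star a)" for a b
  have q0_add_right: "q0 z (x + y) = q0 z x + q0 z y" for x y z
    unfolding q0_sym[of z] by (simp add: q0_add)
  have q0_scale_right: "q0 y (scaleA c x) = cnj c * q0 y x" for c x y
    unfolding q0_sym[of y] by (simp add: q0_scale)
  have dom_q: "complex_of_real (cmod (Z (star a * a))) \<le> q a a" for a
    using q0_dom[of "star a"] by (simp add: q_def A.star_star)
  have "majorant scaleA q (\<lambda>a b. Z (star b * a))"
  proof unfold_locales
    show "hermitian_form_on scaleA UNIV q"
      unfolding hermitian_form_on_def q_def
      by (intro conjI ballI allI q0_sym)
        (simp_all add: A.star_add A.star_scale q0_add_right q0_scale_right)
    \<comment> \<open>Read off from domination, since \<open>q a a\<close> lies above a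
      modulus.\<close>
    show "0 \<le> q a a" for a
      using dom_q[of a] by (auto simp: less_eq_complex_def intro: order_trans[OF norm_ge_zero])
    have Z_sym: "Z (star y * x) = cnj (Z (star x * y))" for x y
      using herm[unfolded hermitian_functional_def, rule_format, of "star x * y"]
      by (simp add: A.star_mult A.star_star)
    show "hermitian_form_on scaleA UNIV (\<lambda>a b. Z (star b * a))"
      unfolding hermitian_form_on_def
      by (intro conjI ballI allI Z_sym) (simp_all add: distrib_left Z.add A.mult_scale_right Z.scale)
    show "cmod (Z (star a * a)) \<le> Re (q a a)" for a
      using dom_q[of a] by (simp add: less_eq_complex_def)
  qed (rule A.subspace_UNIV)+
  then show ?thesis by blast
qed

section \<open>The GNS representation on the antidual\<close>

locale gns_construction = complex_star_algebra scaleA star +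
  self_dual_majorant scaleA q "\<lambda>a b. Z (star b * a)"
  for scaleA :: "complex \<Rightarrow> 'a::ring_1 \<Rightarrow> 'a" and star q Z
begin

text \<open>Plays the part of the class of \<open>a\<close> in the classical GNS quotient.\<close>

definition e :: "'a \<Rightarrow> 'a \<Rightarrow> complex" where
  "e a = (\<lambda>b. Z (star b * a))"

text \<open>The formula extends left multiplication \<open>e a \<mapsto> e (x * a)\<close> to all
  functions. No estimate of \<open>form_norm q (star x * b)\<close> by \<open>form_norm q b\<close>
  is at hand, so invariance is claimed for \<open>range e\<close> only.\<close>

definition \<pi> :: "'a \<Rightarrow> ('a \<Rightarrow> complex) \<Rightarrow> 'a \<Rightarrow> complex" where
  "\<pi> x \<phi> = (\<lambda>b. \<phi> (star x * b))"

lemma \<pi>_e: "\<pi> x (e a) = e (x * a)"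
  by (simp add: \<pi>_def e_def star_mult star_star mult.assoc)

lemma star_one: "star 1 = 1"
  by (metis mult_1_left mult_1_right star_mult star_star)

lemma e_mem: "e a \<in> dual"
  unfolding e_def by (rule B_mem_dual)

lemma krein_form_e: "\<phi> \<in> dual \<Longrightarrow> krein_form \<phi> (e b) = \<phi> b"
  unfolding e_def by (rule krein_form_B)

lemma subspace_range_e: "module.subspace fun_scale (range e)"
proof -
  interpret F: vector_space fun_scale by (rule vector_space_fun_scale)
  have eqs: "e a + e b = e (a + b)" "fun_scale c (e a) = e (scaleA c a)" for a b c
    unfolding e_def by (simp_all add: B_add B_scale fun_eq_iff)
  have "e 0 = 0" using B.zero_left by (simp add: e_def fun_eq_iff)
  then show ?thesis
    by (intro F.subspaceI) (auto simp: eqs intro: range_eqI[of _ _ 0])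
qed

interpretation M: Metric_space dual "ip_dist dual (dual_ip q)" by (rule Metric_space_dual)

lemma cmod_eval_diff_le:
  "\<phi> \<in> dual \<Longrightarrow> \<psi> \<in> dual \<Longrightarrow> cmod (\<phi> b - \<psi> b) \<le> ip_dist dual (dual_ip q) \<phi> \<psi> * form_norm q b"
  using bounded_by_dual_norm[OF dual.closed(3), of \<phi> \<psi>] by (simp add: bounded_by_def dual.ip_dist_eq)

text \<open>Any pair \<open>(\<phi>, \<psi>)\<close> in the closure of the graph satisfies \<open>\<psi> b = \<phi> (star x * b)\<close>, since
  evaluations are continuous.\<close>

lemma closable_\<pi>: "closable_operator dual (dual_ip q) (range e) (\<pi> x)"
proof -
  let ?G = "(\<lambda>\<phi>. (\<phi>, \<pi> x \<phi>)) ` range e"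
  let ?cl = "prod_topology M.mtopology M.mtopology closure_of ?G"
  have graph: "\<psi> b = \<phi> (star x * b)" if cl: "(\<phi>, \<psi>) \<in> ?cl" for \<phi> \<psi> b
  proof -
    have mem: "\<phi> \<in> dual" "\<psi> \<in> dual"
      using cl closure_of_subset_topspace by fastforce+
    let ?C = "form_norm q b + form_norm q (star x * b)"
    have bound: "cmod (\<psi> b - \<phi> (star x * b)) \<le> \<epsilon> * ?C" if "0 < \<epsilon>" for \<epsilon>
    proof -
      let ?U = "M.mball \<phi> \<epsilon> \<times> M.mball \<psi> \<epsilon>"
      have "openin (prod_topology M.mtopology M.mtopology) ?U"
        by (simp add: openin_prod_Times_iff)
      moreover have "(\<phi>, \<psi>) \<in> ?U" using mem \<open>0 < \<epsilon>\<close> by simp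
      ultimately have "\<exists>p. p \<in> ?G \<and> p \<in> ?U"
        using conjunct2[OF cl[unfolded in_closure_of], rule_format, of ?U] by blast
      then obtain a where a: "e a \<in> M.mball \<phi> \<epsilon>" "\<pi> x (e a) \<in> M.mball \<psi> \<epsilon>" by auto
      have "cmod (\<psi> b - \<phi> (star x * b)) \<le>
          cmod (\<psi> b - \<pi> x (e a) b) + cmod (\<phi> (star x * b) - e a (star x * b))"
        using norm_triangle_ineq4[of "\<psi> b - \<pi> x (e a) b" "\<phi> (star x * b) - e a (star x * b)"]
        by (simp add: \<pi>_def)
      also have "\<dots> \<le> \<epsilon> * form_norm q b + \<epsilon> * form_norm q (star x * b)"
      proof (rule add_mono)
        show "cmod (\<psi> b - \<pi> x (e a) b) \<le> \<epsilon> * form_norm q b"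
          by (rule order_trans[OF cmod_eval_diff_le])
            (use a(2) in \<open>auto intro!: mult_right_mono form_norm_nonneg\<close>)
        show "cmod (\<phi> (star x * b) - e a (star x * b)) \<le> \<epsilon> * form_norm q (star x * b)"
          by (rule order_trans[OF cmod_eval_diff_le])
            (use a(1) in \<open>auto intro!: mult_right_mono form_norm_nonneg\<close>)
      qed
      finally show ?thesis by (simp add: distrib_left)
    qed
    have "((\<lambda>\<epsilon>. \<epsilon> * ?C) \<longlongrightarrow> 0 * ?C) (at_right 0)" by (intro tendsto_intros)
    then have "cmod (\<psi> b - \<phi> (star x * b)) \<le> 0 * ?C"
      by (rule tendsto_lowerbound)
        (rule eventually_mono[OF eventually_at_right_less bound], simp_all)
    then show ?thesis by simp
  qed
  show ?thesis
    unfolding closable_operator_def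
  proof (rule single_valuedI)
    fix \<phi> \<psi> \<psi>' assume cl: "(\<phi>, \<psi>) \<in> ?cl" "(\<phi>, \<psi>') \<in> ?cl"
    show "\<psi> = \<psi>'" by (rule ext) (simp only: graph[OF cl(1)] graph[OF cl(2)])
  qed
qed

lemma closable_representation_\<pi>:
  "closable_representation scaleA fun_scale dual (dual_ip q) (range e) \<pi>"
  unfolding closable_representation_def
proof (intro conjI allI ballI)
  show "module.subspace fun_scale (range e)" by (rule subspace_range_e)
  show "range e \<subseteq> dual" using e_mem by blast
  show "M.mtopology closure_of range e = dual"
  proof (rule antisym)
    show "M.mtopology closure_of range e \<subseteq> dual" using closure_of_subset_topspace by fastforce
    show "dual \<subseteq> M.mtopology closure_of range e"
    proof
      fix \<phi> assume \<phi>: "\<phi> \<in> dual"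
      have "\<exists>\<psi>\<in>range e. \<psi> \<in> M.mball \<phi> \<epsilon>" if "0 < \<epsilon>" for \<epsilon>
      proof -
        obtain a where a: "form_norm (dual_ip q) (\<phi> - e a) \<le> \<epsilon> / 2"
          using range_B_dense[OF \<phi>, of "\<epsilon> / 2"] \<open>0 < \<epsilon>\<close> unfolding e_def by auto
        have "ip_dist dual (dual_ip q) \<phi> (e a) < \<epsilon>"
          using a \<open>0 < \<epsilon>\<close> by (simp add: dual.ip_dist_eq \<phi> e_mem)
        then show ?thesis using \<phi> e_mem by auto
      qed
      then show "\<phi> \<in> M.mtopology closure_of range e"
        using \<phi> unfolding M.metric_closure_of by blast
    qed
  qed
  show "closable_operator dual (dual_ip q) (range e) (\<pi> a)" for a by (rule closable_\<pi>)
  show "linear_into fun_scale (range e) (range e) (\<pi> a)" for a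
    unfolding linear_into_def
  proof (intro conjI ballI allI)
    show "\<pi> a \<phi> \<in> range e" if "\<phi> \<in> range e" for \<phi>
      using that by (auto simp: \<pi>_e)
  qed (simp_all add: \<pi>_def fun_eq_iff)
  show "\<pi> (a + b) \<phi> = \<pi> a \<phi> + \<pi> b \<phi>" if "\<phi> \<in> range e" for a b \<phi>
    using that e_mem by (auto simp: \<pi>_def star_add distrib_right dual_add fun_eq_iff)
  \<comment> \<open>The conjugation caused by \<open>star\<close> and the one caused by
    antilinearity of \<open>\<phi>\<close> cancel.\<close>
  show "\<pi> (scaleA c a) \<phi> = fun_scale c (\<pi> a \<phi>)" if "\<phi> \<in> range e" for c a \<phi>
    using that e_mem by (auto simp: \<pi>_def star_scale mult_scale_left dual_scale fun_eq_iff)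
  show "\<pi> (a * b) \<phi> = \<pi> a (\<pi> b \<phi>)" if "\<phi> \<in> range e" for a b \<phi>
    by (simp add: \<pi>_def star_mult mult.assoc)
qed

text \<open>Pairing with \<open>e b\<close> is evaluation at \<open>b\<close>, so both sides of the
  adjoint relation are the value of \<open>\<phi>\<close> at \<open>star a * b\<close>. Testing
  against all \<open>e c\<close> reads off every value of a candidate \<open>z\<close>, up to
  conjugation, and gives uniqueness.\<close>

lemma hermitian_representation_\<pi>: "hermitian_representation star dual krein_form (range e) \<pi>"
  unfolding hermitian_representation_def
proof (intro allI conjI subsetI ballI)
  fix a y assume "y \<in> range e"
  then obtain b where y: "y = e b" by blast
  have adj: "krein_form (\<pi> a \<phi>) y = krein_form \<phi> (e (star a * b))" if \<phi>: "\<phi> \<in> range e" for \<phi>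
  proof -
    have "\<phi> \<in> dual" "\<pi> a \<phi> \<in> dual" using \<phi> e_mem by (auto simp: \<pi>_e)
    then show ?thesis by (simp add: y krein_form_e) (simp add: \<pi>_def)
  qed
  then show "y \<in> krein_adjoint_domain dual krein_form (range e) (\<pi> a)"
    unfolding krein_adjoint_domain_def using e_mem y by blast
  have "z = e (star a * b)"
    if z: "z \<in> dual" "\<forall>\<phi>\<in>range e. krein_form (\<pi> a \<phi>) y = krein_form \<phi> z" for z
  proof
    fix c
    have "krein_form (e c) z = krein_form (e c) (e (star a * b))"
      using z(2) adj[of "e c"] by simp
    then show "z c = e (star a * b) c"
      using krein.form_sym[OF e_mem z(1), of c] krein.form_sym[OF e_mem e_mem, of c "star a * b"]
        krein_form_e[OF z(1), of c] krein_form_e[OF e_mem, of "star a * b" c]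
      by (metis complex_cnj_cancel_iff)
  qed
  then show "krein_adjoint dual krein_form (range e) (\<pi> a) y = \<pi> (star a) y"
    unfolding krein_adjoint_def y \<pi>_e
    by (intro the_equality) (use e_mem adj y in auto)
qed

lemma gns_data: "gns_data scaleA star Z fun_scale dual krein_form (range e) \<pi> (e 1)"
  unfolding gns_data_def
proof (intro conjI exI allI)
  interpret F: vector_space fun_scale by (rule vector_space_fun_scale)
  show "krein_structure fun_scale dual krein_form (dual_ip q) J" by (rule krein_structure)
  show "closable_representation scaleA fun_scale dual (dual_ip q) (range e) \<pi>"
    by (rule closable_representation_\<pi>)
  show "hermitian_representation star dual krein_form (range e) \<pi>"
    by (rule hermitian_representation_\<pi>)
  show "e 1 \<in> range e" by simp
  show "Z a = krein_form (\<pi> a (e 1)) (e 1)" for a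
    by (simp add: \<pi>_e krein_form_e e_mem) (simp add: e_def star_one)
  show "F.span (range (\<lambda>a. \<pi> a (e 1))) = range e"
    using subspace_range_e by (simp add: \<pi>_e)
qed

end

text \<open>The second conjunct starts from a Krein space in an arbitrary host type. Combined with
  the first, it shows that GNS data in any host yield GNS data in the function space fixed by
  \<open>admits_gns_data\<close>, so that choice of host loses no generality.\<close>

theorem theorem6p2:
  fixes scaleA :: "complex \<Rightarrow> 'a::ring_1 \<Rightarrow> 'a"
    and star :: "'a \<Rightarrow> 'a"
    and Z :: "'a \<Rightarrow> complex"
    and scaleK :: "complex \<Rightarrow> 'k::ab_group_add \<Rightarrow> 'k"
  assumes "complex_star_algebra scaleA star"
    and "Vector_Spaces.linear scaleA (*) Z"
    and "hermitian_functional star Z"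
    and "Z 1 = 1"
  shows "(admits_gns_data scaleA star Z \<longleftrightarrow>
            (\<exists>L. positive_definite_kernel L \<and> dominated_by_kernel scaleA star Z L)) \<and>
         (admits_gns_data_in scaleK scaleA star Z \<longrightarrow>
            (\<exists>L. positive_definite_kernel L \<and> dominated_by_kernel scaleA star Z L))"
proof (intro conjI iffI impI)
  assume "\<exists>L. positive_definite_kernel L \<and> dominated_by_kernel scaleA star Z L"
  then obtain q where "majorant scaleA q (\<lambda>a b. Z (star b * a))"
    using kernel_imp_majorant[OF assms(1-3)] by blast
  then interpret majorant scaleA q "\<lambda>a b. Z (star b * a)" .
  interpret L: self_dual_majorant scaleA majorant_lim "\<lambda>a b. Z (star b * a)"
    by (intro self_dual_majorant.intro self_dual_majorant_axioms.intro
        majorant_majorant_lim self_dual_majorant_lim)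
  interpret complex_star_algebra scaleA star by (rule assms(1))
  interpret gns_construction scaleA star majorant_lim Z ..
  show "admits_gns_data scaleA star Z"
    unfolding admits_gns_data_def admits_gns_data_in_def using gns_data by blast
qed (use gns_data_imp_kernel[OF assms(1,2)] in
    \<open>unfold admits_gns_data_def admits_gns_data_in_def, blast+\<close>)

end
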